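(* Let $M>0$. For any given $\xi>0$ and $R\in(0,1)$, there is a standard position Sasaki geodesic in $\mathbb{R}\mathbb{D}$ (for the mass-$M$ Sasaki metric) with multiplicity $m=0$, ending on the target circle $|w|=R$ and having invariant twist $\xi$, such that it is the unique geodesic in standard position that minimizes the Sasaki length $\Lambda$ among all standard position geodesics ending on the target circle of radius $R$ (in $\mathbb{D}$) with invariant twist $\xi$.
   Context: Fix a mass parameter $M>0$. Let $\mathbb{D}=\{w=x+iy:|w|<1\}$ with the Poincaré metric $2|dw|/(1-|w|^2)$. Let $\mathbb{R}\mathbb{D}=\mathbb{R}\times\mathbb{D}$, with elements written $\phi@w$ (representing the tangent direction $e^{i\phi}$ at $w$, with the angle $\phi$ tracked as a real number; this is the universal cover of the unit tangent bundle of $\mathbb{D}$). It carries the mass-$M$ Sasaki metric $$ds^2=\frac{4|dw|^2}{(1-|w|^2)^2}+\frac1M\eta^2,\qquad \eta=d\phi+2\,\frac{x\,dy-y\,dx}{1-x^2-y^2}.$$ A Sasaki geodesic is a constant speed geodesic $\sigma(t)=\phi(t)@w(t)$ of this metric, $t\in[0,T]$; the Sasaki length $\Lambda$ is its length in this metric, and its base curve is $t\mapsto w(t)$. The base curve has constant Poincaré speed $v$ and, when $v>0$, constant signed Poincaré curvature $\kappa$ (positive when turning clockwise), $\kappa=\eta(\dot\sigma)/(Mv)$. A geodesic is in standard position if $\sigma(0)=0@0$ and $\dot w(0)=v/2$ with $v>0$ (base velocity in the direction of the positive $x$-axis). Geodesics are identified when they differ by a linear rescaling of time. The base curve of a standard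 position geodesic runs along the "dipole circle" of Euclidean radius $r=\frac1{2|\kappa|}\in(0,\infty]$ tangent to the $x$-axis at $0$ (below the axis and clockwise when $\kappa>0$, above and counterclockwise when $\kappa<0$, the $x$-axis when $\kappa=0$). The geodesic is elliptic if $|\kappa|>1$ (the circle is contained in $\mathbb{D}$), parabolic if $|\kappa|=1$, hyperbolic if $0<|\kappa|<1$, Teichmüller if $\kappa=0$. For $R\in(0,1)$ the target circle is $\{|w|=R\}$; a geodesic on $[0,T]$ ends on it if $|w(T)|=R$. The invariant twist of a geodesic starting at base point $w(0)=0$ is $\xi=\phi(T)-\phi(0)$. The multiplicity $m\in\{0,1,2,\dots\}$ of a standard position geodesic ending on the target circle is the number of complete revolutions its base curve makes around the dipole circle ($m=0$ always in the non-elliptic cases); so $m=0$ means that the base curve makes less than one full revolution. *)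

theory Defs
  imports "HOL-Complex_Analysis.Complex_Analysis"
begin

text \<open>Riemannian metrics are given in a single chart: a map assigning to each point of an open
  subset of \<^typ>\<open>real ^ 'n\<close> the Gram matrix of the metric in the coordinate basis.\<close>

definition coord_deriv :: "'n::finite \<Rightarrow> (real ^ 'n \<Rightarrow> real) \<Rightarrow> real ^ 'n \<Rightarrow> real" where
  "coord_deriv k f p = deriv (\<lambda>s. f (p + s *\<^sub>R axis k 1)) 0"

definition christoffel ::
    "(real ^ 'n \<Rightarrow> real ^ 'n ^ 'n) \<Rightarrow> 'n::finite \<Rightarrow> 'n \<Rightarrow> 'n \<Rightarrow> real ^ 'n \<Rightarrow> real" where
  "christoffel g k i j p =
     1/2 * (\<Sum>l\<in>UNIV. matrix_inv (g p) $ k $ l *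
       (coord_deriv i (\<lambda>q. g q $ j $ l) p
        + coord_deriv j (\<lambda>q. g q $ i $ l) p
        - coord_deriv l (\<lambda>q. g q $ i $ j) p))"

definition velocity :: "real \<Rightarrow> (real \<Rightarrow> 'a::real_normed_vector) \<Rightarrow> real \<Rightarrow> 'a" where
  "velocity T c t = vector_derivative c (at t within {0..T})"

text \<open>Affinely parametrized geodesics on \<open>[0,T]\<close>, with one-sided derivatives at the endpoints.
  The geodesic equation forces the speed to be constant; the values of the curve outside
  \<open>[0,T]\<close> are irrelevant.\<close>

definition geodesic_on ::
    "(real ^ 'n \<Rightarrow> real ^ 'n ^ 'n) \<Rightarrow> (real ^ 'n::finite) set \<Rightarrow> real \<Rightarrow> (real \<Rightarrow> real ^ 'n) \<Rightarrow> bool" where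
  "geodesic_on g U T \<sigma> \<longleftrightarrow> 0 < T \<and>
     (\<exists>\<sigma>' \<sigma>''. \<forall>t\<in>{0..T}. \<sigma> t \<in> U \<and>
        (\<sigma> has_vector_derivative \<sigma>' t) (at t within {0..T}) \<and>
        (\<sigma>' has_vector_derivative \<sigma>'' t) (at t within {0..T}) \<and>
        (\<forall>k. \<sigma>'' t $ k +
          (\<Sum>i\<in>UNIV. \<Sum>j\<in>UNIV. christoffel g k i j (\<sigma> t) * \<sigma>' t $ i * \<sigma>' t $ j) = 0))"

definition riemannian_length ::
    "(real ^ 'n \<Rightarrow> real ^ 'n ^ 'n) \<Rightarrow> real \<Rightarrow> (real \<Rightarrow> real ^ 'n::finite) \<Rightarrow> real" where
  "riemannian_length g T \<sigma> =
     integral {0..T} (\<lambda>t. sqrt (velocity T \<sigma> t \<bullet> (g (\<sigma> t) *v velocity T \<sigma> t)))"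

text \<open>The point \<open>\<phi>@(x + iy)\<close> is the vector with coordinates \<open>1, 2, 3\<close> equal to
  \<open>\<phi>, x, y\<close>.\<close>

definition angle :: "real ^ 3 \<Rightarrow> real" where
  "angle p = p $ 1"

definition base :: "real ^ 3 \<Rightarrow> complex" where
  "base p = Complex (p $ 2) (p $ 3)"

definition RD :: "(real ^ 3) set" where
  "RD = {p. cmod (base p) < 1}"

definition eta :: "real ^ 3 \<Rightarrow> real ^ 3 \<Rightarrow> real" where
  "eta p u = u $ 1 + 2 * (p $ 2 * u $ 3 - p $ 3 * u $ 2) / (1 - (p $ 2)\<^sup>2 - (p $ 3)\<^sup>2)"

text \<open>The polarization of
  \<open>ds\<^sup>2 = 4 |dw|\<^sup>2 / (1 - |w|\<^sup>2)\<^sup>2 + \<eta>\<^sup>2 / M\<close>.\<close>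

definition sasaki_form :: "real \<Rightarrow> real ^ 3 \<Rightarrow> real ^ 3 \<Rightarrow> real ^ 3 \<Rightarrow> real" where
  "sasaki_form M p u v =
     4 * (base u \<bullet> base v) / (1 - (cmod (base p))\<^sup>2)\<^sup>2 + 1 / M * (eta p u * eta p v)"

definition sasaki_metric :: "real \<Rightarrow> real ^ 3 \<Rightarrow> real ^ 3 ^ 3" where
  "sasaki_metric M p = (\<chi> i j. sasaki_form M p (axis i 1) (axis j 1))"

definition sasaki_geodesic :: "real \<Rightarrow> real \<Rightarrow> (real \<Rightarrow> real ^ 3) \<Rightarrow> bool" where
  "sasaki_geodesic M = geodesic_on (sasaki_metric M) RD"

definition sasaki_length :: "real \<Rightarrow> real \<Rightarrow> (real \<Rightarrow> real ^ 3) \<Rightarrow> real" where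
  "sasaki_length M = riemannian_length (sasaki_metric M)"

definition base_speed :: "real \<Rightarrow> (real \<Rightarrow> real ^ 3) \<Rightarrow> real \<Rightarrow> real" where
  "base_speed T \<sigma> t = 2 * cmod (velocity T (base \<circ> \<sigma>) t) / (1 - (cmod (base (\<sigma> t)))\<^sup>2)"

text \<open>The signed curvature of the base curve (positive when turning clockwise) is constant
  along a geodesic and equals \<open>\<eta>(\<sigma>') / (M v)\<close>, so it is read off at time 0.\<close>

definition base_curvature :: "real \<Rightarrow> real \<Rightarrow> (real \<Rightarrow> real ^ 3) \<Rightarrow> real" where
  "base_curvature M T \<sigma> = eta (\<sigma> 0) (velocity T \<sigma> 0) / (M * base_speed T \<sigma> 0)"

definition standard_position :: "real \<Rightarrow> real \<Rightarrow> (real \<Rightarrow> real ^ 3) \<Rightarrow> bool" where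
  "standard_position M T \<sigma> \<longleftrightarrow> sasaki_geodesic M T \<sigma> \<and> angle (\<sigma> 0) = 0 \<and> base (\<sigma> 0) = 0 \<and>
     (\<exists>v>0. velocity T (base \<circ> \<sigma>) 0 = complex_of_real (v / 2))"

definition ends_on_circle :: "real \<Rightarrow> real \<Rightarrow> (real \<Rightarrow> real ^ 3) \<Rightarrow> bool" where
  "ends_on_circle R T \<sigma> \<longleftrightarrow> cmod (base (\<sigma> T)) = R"

definition invariant_twist :: "real \<Rightarrow> (real \<Rightarrow> real ^ 3) \<Rightarrow> real" where
  "invariant_twist T \<sigma> = angle (\<sigma> T) - angle (\<sigma> 0)"

text \<open>The dipole circle has radius \<open>1 / (2 |\<kappa>|)\<close> and is tangent to the real axis at 0, below
  the axis if \<open>\<kappa> > 0\<close> and above it if \<open>\<kappa> < 0\<close>.\<close>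

definition dipole_centre :: "real \<Rightarrow> complex" where
  "dipole_centre \<kappa> = Complex 0 (- 1 / (2 * \<kappa>))"

text \<open>For a path that need not be closed, the real part of the winding number is the total signed
  angle swept around the centre, divided by \<open>2\<pi>\<close>; clockwise motion counts negatively, hence the
  absolute value.\<close>

definition geodesic_multiplicity :: "real \<Rightarrow> real \<Rightarrow> (real \<Rightarrow> real ^ 3) \<Rightarrow> nat" where
  "geodesic_multiplicity M T \<sigma> =
     (let \<kappa> = base_curvature M T \<sigma> in
      if \<bar>\<kappa>\<bar> > 1
      then nat \<lfloor>\<bar>Re (winding_number (\<lambda>s. base (\<sigma> (s * T))) (dipole_centre \<kappa>))\<bar>\<rfloor>
      else 0)"

definition same_up_to_rescaling ::
    "real \<Rightarrow> (real \<Rightarrow> 'a) \<Rightarrow> real \<Rightarrow> (real \<Rightarrow> 'a) \<Rightarrow> bool" where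
  "same_up_to_rescaling T \<sigma> S \<tau> \<longleftrightarrow> (\<exists>c>0. S = c * T \<and> (\<forall>t\<in>{0..T}. \<tau> (c * t) = \<sigma> t))"

definition admissible :: "real \<Rightarrow> real \<Rightarrow> real \<Rightarrow> real \<Rightarrow> (real \<Rightarrow> real ^ 3) \<Rightarrow> bool" where
  "admissible M R \<xi> T \<sigma> \<longleftrightarrow>
     standard_position M T \<sigma> \<and> ends_on_circle R T \<sigma> \<and> invariant_twist T \<sigma> = \<xi>"

end

theory Submission
  imports Defs "HOL-Real_Asymp.Real_Asymp"
begin

text \<open>With unit base speed and curvature \<open>\<kappa>\<close>, a standard geodesic has base curve
  \<open>w = S / (C + i \<kappa> S)\<close>, where \<open>S' = C / 2\<close> and \<open>C' = (1 - \<kappa>\<^sup>2) S / 2\<close>, and angle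
  \<open>\<phi>(s) = (M + 1) \<kappa> s - 2 arg (C + i \<kappa> S)\<close>. On multiplicity 0 the value \<open>X = C(T)\<close> parametrizes all
  geodesics ending on the target circle, and the twist is strictly decreasing in \<open>X\<close>; hence there is
  exactly one of twist \<open>\<xi>\<close>. A geodesic of positive multiplicity is compared with the arc of
  multiplicity 0 having the same base length: that arc sweeps at least as much area (an isoperimetric
  inequality), and \<open>L\<^sup>2 + (\<xi> - A(L))\<^sup>2 / M\<close>, with \<open>A(L)\<close> the area swept by the simple arc of
  length \<open>L\<close>, is minimal exactly at the multiplicity 0 geodesic of twist \<open>\<xi>\<close>.\<close>

text \<open>The curvature cannot serve as parameter: for each \<kappa> in (1, 1/R) the dipole circle
  crosses the target circle twice, before and after its point farthest from 0. The cosine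
  \<open>X\<close> separates the two crossings. With \<open>c = sqrt (1 - R^2)\<close>, the value
  \<open>X = 1 / c\<close> is the straight segment, \<open>X = 1\<close> the parabolic arc,
  \<open>X = 0\<close> the circle of curvature 1/R that just touches the target circle, and
  \<open>X\<close> near -1 an almost complete circuit with \<kappa> near 1 and unbounded length.
  Twist and length are linked by area: the exterior derivative of \<eta> is the area form of the
  disc, so \<kappa> L - 2 arg (C + i \<kappa> S) is the area A swept by the radius from 0, and the
  twist is M \<kappa> L + A. The squared Sasaki length L^2 (1 + M \<kappa>^2) is therefore L^2 +
  (\<xi> - A)^2 / M for every multiplicity. The obstacle is that a multiple cover may have the
  shorter base curve; only its smaller area then shows that it loses.\<close>

no_notation fps_nth (infixl "$" 75)

subsection \<open>Twist and length as functions of the end of the arc\<close>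

text \<open>The analytic function taking \<open>cos u\<close> to \<open>u / sin u\<close>, continued
  past \<open>X = 1\<close> by \<open>cosh h\<close> to \<open>h / sinh h\<close>. Elliptic,
  parabolic and hyperbolic arcs thereby form a single family in \<open>X\<close>.\<close>

definition inv_sinc :: "real \<Rightarrow> real" where
  "inv_sinc X = (if X < 1 then arccos X / sqrt (1 - X\<^sup>2)
                 else if X = 1 then 1 else arcosh X / sqrt (X\<^sup>2 - 1))"

lemma inv_sinc_cos:
  assumes "0 < u" "u < pi"
  shows "inv_sinc (cos u) = u / sin u"
proof -
  have "cos u < cos 0"
    using assms by (intro cos_monotone_0_pi) auto
  moreover have "sqrt (1 - (cos u)\<^sup>2) = sin u"
    using assms sin_gt_zero[of u] by (simp add: sin_squared_eq[symmetric])
  ultimately show ?thesis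
    using assms by (simp add: inv_sinc_def arccos_cos)
qed

lemma inv_sinc_cosh:
  assumes "0 < h"
  shows "inv_sinc (cosh h) = h / sinh h"
proof -
  have "1 < cosh h"
    using assms cosh_real_ge_1[of h] cosh_real_one_iff[of h] by linarith
  moreover have "sqrt ((cosh h)\<^sup>2 - 1) = sinh h"
    using assms by (simp add: sinh_square_eq[symmetric])
  ultimately show ?thesis
    using assms by (simp add: inv_sinc_def arcosh_cosh_real)
qed

lemma isCont_inv_sinc_1: "isCont inv_sinc 1"
proof -
  \<comment> \<open>The left branch is tested in the angle \<open>u = arccos X\<close>, the right
    branch directly in \<open>X\<close>.\<close>
  have "((\<lambda>u. u / sin u) \<longlongrightarrow> (1::real)) (at_right 0)" by real_asymp
  moreover have "filterlim arccos (at_right 0) (at_left (1::real))"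
    unfolding filterlim_at
  proof
    have "continuous_on {-1..1} arccos" by (intro continuous_intros) auto
    then have "(arccos \<longlongrightarrow> arccos 1) (at 1 within {-1..1})"
      unfolding continuous_on_def by (rule bspec) simp
    moreover have "at_left (1::real) \<le> at 1 within {-1..1}"
      using at_within_Icc_at_left[of "-1" "1::real"] by simp
    ultimately show "(arccos \<longlongrightarrow> 0) (at_left 1)"
      by (simp add: tendsto_mono)
    show "\<forall>\<^sub>F x in at_left (1::real). arccos x \<in> {0<..} \<and> arccos x \<noteq> 0"
      unfolding eventually_at_left_field
    proof (intro exI[of _ 0] conjI allI impI)
      fix y :: real assume "0 < y" "y < 1"
      then show "arccos y \<in> {0<..}" "arccos y \<noteq> 0" using arccos_lt_bounded[of y] by auto
    qed simp
  qed
  ultimately have "((\<lambda>X. arccos X / sin (arccos X)) \<longlongrightarrow> 1) (at_left 1)"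
    by (rule filterlim_compose)
  moreover have "\<forall>\<^sub>F x in at_left (1::real). arccos x / sin (arccos x) = inv_sinc x"
    unfolding eventually_at_left_field
    by (rule exI[of _ 0]) (auto simp: inv_sinc_def sin_arccos)
  ultimately have left: "(inv_sinc \<longlongrightarrow> 1) (at_left 1)"
    by (rule Lim_transform_eventually)
  have "((\<lambda>X::real. arcosh X / sqrt (X\<^sup>2 - 1)) \<longlongrightarrow> 1) (at_right 1)" by real_asymp
  moreover have "\<forall>\<^sub>F x in at_right (1::real). arcosh x / sqrt (x\<^sup>2 - 1) = inv_sinc x"
    unfolding eventually_at_right_field by (rule exI[of _ 2]) (auto simp: inv_sinc_def)
  ultimately have right: "(inv_sinc \<longlongrightarrow> 1) (at_right 1)"
    by (rule Lim_transform_eventually)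
  have "inv_sinc 1 = 1" by (simp add: inv_sinc_def)
  with left right show ?thesis
    by (simp add: isCont_def filterlim_split_at)
qed

section \<open>Monotonicity of u / sin u as a function of the cosine\<close>

lemma u_cos_less_sin:
  assumes "0 < u" "u < pi"
  shows "u * cos u < sin (u::real)"
proof -
  have "(\<lambda>x. sin x - x * cos x) 0 < (\<lambda>x. sin x - x * cos x) u"
    by (rule DERIV_pos_imp_increasing_open[OF assms(1)])
      (use assms in \<open>auto intro!: exI derivative_eq_intros continuous_intros sin_gt_zero mult_pos_pos\<close>)
  then show ?thesis by simp
qed

lemma sinh_less_h_cosh:
  assumes "0 < h"
  shows "sinh h < h * cosh (h::real)"
proof -
  have "(\<lambda>x. x * cosh x - sinh x) 0 < (\<lambda>x. x * cosh x - sinh x) h"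
    by (rule DERIV_pos_imp_increasing_open[OF assms(1)])
      (use assms in \<open>auto intro!: exI derivative_eq_intros continuous_intros mult_pos_pos\<close>)
  then show ?thesis by simp
qed

text \<open>Both branches satisfy \<open>(1 - X^2) f' = X f - 1\<close>. The right side changes sign
  at \<open>X = 1\<close> together with \<open>1 - X^2\<close>, by \<open>u cos u < sin u\<close> on
  the left and \<open>sinh h < h cosh h\<close> on the right, so the slope stays negative.\<close>

lemma inv_sinc_deriv:
  assumes "-1 < X" "X \<noteq> 1"
  obtains f' where "(inv_sinc has_real_derivative f') (at X)" "f' < 0"
    "(1 - X\<^sup>2) * f' = X * inv_sinc X - 1"
proof (cases "X < 1")
  case True
  define u where "u = arccos X"
  have u: "0 < u" "u < pi" "cos u = X"
    using assms True arccos_lt_bounded[of X] by (auto simp: u_def)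
  have sq: "0 < 1 - X\<^sup>2" using assms True by (simp add: abs_square_less_1)
  define f' where "f' = (X * inv_sinc X - 1) / (1 - X\<^sup>2)"
  have "((\<lambda>x. arccos x / sqrt (1 - x\<^sup>2)) has_real_derivative f') (at X)"
    unfolding f'_def
    using sq assms True
    apply (auto intro!: derivative_eq_intros simp: inv_sinc_def)
    apply (simp add: field_simps power2_eq_square)
    done
  then have "(inv_sinc has_real_derivative f') (at X)"
    by (rule has_field_derivative_transform_within_open[of _ _ _ "{..<1}"])
      (use True in \<open>auto simp: inv_sinc_def\<close>)
  moreover have "X * inv_sinc X < 1"
    using u_cos_less_sin[OF u(1,2)] sin_gt_zero[OF u(1,2)] inv_sinc_cos[OF u(1,2)]
    unfolding u(3) by (simp add: divide_less_eq mult.commute)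
  then have "f' < 0" using sq by (simp add: f'_def divide_neg_pos)
  moreover have "(1 - X\<^sup>2) * f' = X * inv_sinc X - 1" using sq by (simp add: f'_def)
  ultimately show ?thesis using that by blast
next
  case False
  then have X: "1 < X" using assms by simp
  define h where "h = arcosh X"
  have h: "0 < h" "cosh h = X"
    using X by (auto simp: h_def arcosh_real_gt_1_iff)
  have sq: "0 < X\<^sup>2 - 1" using X by (simp add: power2_eq_square less_1_mult)
  define f' where "f' = (X * inv_sinc X - 1) / (1 - X\<^sup>2)"
  have ne: "X\<^sup>2 \<noteq> 1" using sq by simp
  have eq: "(1 - arcosh X * (inverse (sqrt (X\<^sup>2 - 1)) * X)) / (X\<^sup>2 - 1)
      = (X * arcosh X / sqrt (X\<^sup>2 - 1) - 1) / (1 - X\<^sup>2)"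
    using sq by (simp add: divide_simps) (simp add: algebra_simps)
  have "((\<lambda>x. arcosh x / sqrt (x\<^sup>2 - 1)) has_real_derivative f') (at X)"
    unfolding f'_def
    using X by (auto intro!: derivative_eq_intros simp: inv_sinc_def) (use X sq in \<open>auto simp: eq ne\<close>)
  then have "(inv_sinc has_real_derivative f') (at X)"
    by (rule has_field_derivative_transform_within_open[of _ _ _ "{1<..}"])
      (use X in \<open>auto simp: inv_sinc_def\<close>)
  moreover have "1 < X * inv_sinc X"
    using sinh_less_h_cosh[OF h(1)] h(1) inv_sinc_cosh[OF h(1)]
    unfolding h(2) by (simp add: less_divide_eq mult.commute)
  then have "f' < 0" using sq by (simp add: f'_def divide_pos_neg)
  moreover have "(1 - X\<^sup>2) * f' = X * inv_sinc X - 1" using sq by (simp add: f'_def)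
  ultimately show ?thesis using that by blast
qed

lemma isCont_inv_sinc: "-1 < X \<Longrightarrow> isCont inv_sinc X"
  using isCont_inv_sinc_1 by (cases "X = 1") (auto elim!: inv_sinc_deriv intro: DERIV_isCont)

text \<open>The exceptional point serves for the parabolic value \<open>X = 1\<close>, where the two
  formulas of \<open>inv_sinc\<close> meet and continuity is enough.\<close>

lemma strict_antimono_except_point:
  fixes g :: "real \<Rightarrow> real"
  assumes "a < b" and cont: "continuous_on {a..b} g"
    and neg: "\<And>x. a < x \<Longrightarrow> x < b \<Longrightarrow> x \<noteq> p \<Longrightarrow> \<exists>y. DERIV g x :> y \<and> y < 0"
  shows "g b < g a"
proof (cases "a < p \<and> p < b")
  case True
  have "g p < g a"
    by (rule DERIV_neg_imp_decreasing_open) (use True assms in \<open>auto intro: continuous_on_subset\<close>)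
  moreover have "g b < g p"
    by (rule DERIV_neg_imp_decreasing_open) (use True assms in \<open>auto intro: continuous_on_subset\<close>)
  ultimately show ?thesis by simp
next
  case False
  show ?thesis
    by (rule DERIV_neg_imp_decreasing_open) (use False assms in \<open>auto\<close>)
qed

lemma inv_sinc_strict_antimono:
  assumes "-1 < a" "a < b"
  shows "inv_sinc b < inv_sinc a"
proof (rule strict_antimono_except_point[OF assms(2), where p = 1])
  show "continuous_on {a..b} inv_sinc"
    using assms by (auto intro!: continuous_at_imp_continuous_on isCont_inv_sinc)
  show "\<exists>y. DERIV inv_sinc x :> y \<and> y < 0" if "a < x" "x < b" "x \<noteq> 1" for x
  proof -
    have "-1 < x" using that assms by simp
    from inv_sinc_deriv[OF this that(3)] show ?thesis by blast
  qed
qed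

text \<open>If d is the Poincare distance from 0 to the target circle, then
  \<open>R = tanh (d / 2)\<close> and \<open>c = 1 / cosh (d / 2)\<close>. Hence
  \<open>R / c\<close> and \<open>1 / c\<close> are the values of \<open>sinh\<close> and
  \<open>cosh\<close> at d / 2.\<close>

locale target =
  fixes M R c :: real
  assumes M: "0 < M" and R: "0 < R" and c: "0 < c" and Rc: "R\<^sup>2 + c\<^sup>2 = 1"
begin

text \<open>A geodesic of multiplicity 0 ending on the target circle is encoded by the value \<open>X\<close> of
  \<open>cos (\<omega> T / 2)\<close> (\<open>cosh\<close> in the hyperbolic case), where \<open>T\<close> is the length of the base curve and
  \<open>\<omega>\<^sup>2 = \<bar>1 - \<kappa>\<^sup>2\<bar>\<close>. Base length, twist and
  Sasaki length are halved throughout.\<close>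

definition half_len :: "real \<Rightarrow> real" where
  "half_len X = R / c * inv_sinc X"

text \<open>The solution for \<kappa> of \<open>C^2 = 1 + (1 - \<kappa>^2) S^2\<close> at an end
  point with \<open>C = X\<close> and \<open>S = R / c\<close>.\<close>

definition curv :: "real \<Rightarrow> real" where
  "curv X = sqrt (1 - c\<^sup>2 * X\<^sup>2) / R"

text \<open>Half the hyperbolic area swept by the radius from 0, clockwise counted positive. The end
  value of C + i \<kappa> S has modulus \<open>1 / c\<close> and real part \<open>X\<close>, so its
  argument is \<open>arccos (c * X)\<close>.\<close>

definition half_area :: "real \<Rightarrow> real" where
  "half_area X = curv X * half_len X - arccos (c * X)"

definition half_twist :: "real \<Rightarrow> real" where
  "half_twist X = M * curv X * half_len X + half_area X"

lemma c_less_1: "c < 1"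
  using Rc R c by (smt (verit) power2_less_imp_less one_power2 zero_less_power)

lemma cX:
  assumes "-1 < X" "X < 1 / c"
  shows "-1 < c * X" "c * X < 1" "0 < 1 - c\<^sup>2 * X\<^sup>2"
proof -
  have "c * (-1) < c * X" using assms c by (intro mult_strict_left_mono)
  then show 1: "-1 < c * X" using c_less_1 by simp
  show 2: "c * X < 1" using assms c by (simp add: field_simps)
  have "\<bar>c * X\<bar> < 1" using 1 2 by simp
  then have "(c * X)\<^sup>2 < 1" by (simp add: abs_square_less_1)
  then show "0 < 1 - c\<^sup>2 * X\<^sup>2" by (simp add: power_mult_distrib)
qed

lemma arccos_cX_deriv:
  assumes "-1 < X" "X < 1 / c"
  shows "((\<lambda>X. arccos (c * X)) has_real_derivative - c / sqrt (1 - c\<^sup>2 * X\<^sup>2)) (at X)"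
  using cX[OF assms]
  by (auto intro!: derivative_eq_intros simp: power_mult_distrib divide_inverse)

lemma curv_pos: "-1 < X \<Longrightarrow> X < 1 / c \<Longrightarrow> 0 < curv X"
  using cX(3)[of X] R by (simp add: curv_def)

lemma inv_sinc_pos:
  assumes "-1 < X" shows "0 < inv_sinc X"
proof -
  consider "X < 1" | "X = 1" | "X > 1" by linarith
  then show ?thesis
  proof cases
    case 1
    then show ?thesis using assms arccos_lt_bounded[of X]
      by (auto simp: inv_sinc_def abs_square_less_1 intro!: divide_pos_pos)
  next
    case 3
    then have "0 < X\<^sup>2 - 1" by (simp add: power2_eq_square less_1_mult)
    then show ?thesis using 3 by (simp add: inv_sinc_def)
  qed (simp add: inv_sinc_def)
qed

lemma half_len_pos: "-1 < X \<Longrightarrow> 0 < half_len X"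
  using inv_sinc_pos R c by (simp add: half_len_def)

lemma half_len_antimono: "-1 < a \<Longrightarrow> a < b \<Longrightarrow> half_len b < half_len a"
  using inv_sinc_strict_antimono[of a b] R c by (simp add: half_len_def divide_strict_right_mono)

lemma isCont_half_len: "-1 < X \<Longrightarrow> isCont half_len X"
  unfolding half_len_def by (intro continuous_intros isCont_inv_sinc)

lemma continuous_on_half_len: "continuous_on {-1<..} half_len"
  by (auto intro!: continuous_at_imp_continuous_on isCont_half_len)

text \<open>The end point \<open>1 / c\<close> is included because the twist vanishes there and the
  intermediate value theorem starts from it; \<open>curv\<close> has a square root singularity at
  this point.\<close>

lemma continuous_on_half_area: "continuous_on {-1<..1/c} half_area"
proof -
  have "-1 \<le> c * X \<and> c * X \<le> 1" if "-1 < X" "X \<le> 1 / c" for X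
  proof (cases "X = 1 / c")
    case False
    then show ?thesis using cX[of X] that by auto
  qed (use c in auto)
  then show ?thesis
    unfolding half_area_def curv_def
    by (intro continuous_intros continuous_on_subset[OF continuous_on_half_len]) (use R in auto)
qed

lemma continuous_on_half_twist: "continuous_on {-1<..1/c} half_twist"
  unfolding half_twist_def curv_def
  by (intro continuous_intros continuous_on_half_area continuous_on_subset[OF continuous_on_half_len])
    (use R in auto)

text \<open>The isoperimetric relation: along this family the derivative of the enclosed area with respect
  to the length is \<open>1 / \<kappa>\<close>.\<close>

lemma half_len_area_deriv:
  assumes X: "-1 < X" "X < 1 / c" "X \<noteq> 1"
  obtains l' where "(half_len has_real_derivative l') (at X)" "l' < 0"
    "(half_area has_real_derivative l' / curv X) (at X)"
proof -
  from inv_sinc_deriv[OF X(1,3)] obtain f' where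
    f': "(inv_sinc has_real_derivative f') (at X)" "f' < 0" "(1 - X\<^sup>2) * f' = X * inv_sinc X - 1" .
  define s where "s = sqrt (1 - c\<^sup>2 * X\<^sup>2)"
  have pos: "0 < 1 - c\<^sup>2 * X\<^sup>2" using cX X by blast
  then have s: "0 < s" "s\<^sup>2 = 1 - c\<^sup>2 * X\<^sup>2" by (auto simp: s_def)
  have cs: "curv X = s / R" by (simp add: curv_def s_def)
  have L: "(half_len has_real_derivative R / c * f') (at X)"
    unfolding half_len_def using c by (auto intro!: derivative_eq_intros f')
  have K: "(curv has_real_derivative - (c\<^sup>2 * X) / (s * R)) (at X)"
    unfolding curv_def using pos
    using R c by (auto intro!: derivative_eq_intros simp: s_def field_simps)
  have A: "((\<lambda>X. arccos (c * X)) has_real_derivative - c / s) (at X)"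
    using arccos_cX_deriv[OF X(1,2)] by (simp add: s_def)
  have "(half_area has_real_derivative
      - (c\<^sup>2 * X) / (s * R) * half_len X + curv X * (R / c * f') - (- c / s)) (at X)"
    unfolding half_area_def
    by (intro DERIV_diff A) (auto intro!: derivative_eq_intros K L)
  moreover have "- (c\<^sup>2 * X) / (s * R) * half_len X + curv X * (R / c * f') - (- c / s)
      = (R / c * f') / curv X"
  proof -
    \<comment> \<open>The terms collapse because
      \<open>s^2 - c^2 (1 - X^2) = 1 - c^2 = R^2\<close>.\<close>
    have eq: "s\<^sup>2 * f' - c\<^sup>2 * (X * inv_sinc X - 1) = R\<^sup>2 * f'"
      unfolding f'(3)[symmetric] s(2) using Rc by algebra
    have "- (c\<^sup>2 * X) / (s * R) * half_len X + curv X * (R / c * f') - (- c / s)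
        = (s\<^sup>2 * f' - c\<^sup>2 * (X * inv_sinc X - 1)) / (c * s)"
      using s(1) R c by (simp add: half_len_def cs field_simps power2_eq_square)
    also have "\<dots> = (R / c * f') / curv X"
      unfolding eq using s(1) R c by (simp add: cs power2_eq_square)
    finally show ?thesis .
  qed
  ultimately show ?thesis
    using that[OF L] f'(2) R c by (simp add: mult_pos_neg divide_neg_pos)
qed

lemma half_twist_deriv_neg:
  assumes X: "-1 < X" "X < 1 / c" "X \<noteq> 1"
  shows "\<exists>y. DERIV half_twist X :> y \<and> y < 0"
proof -
  from half_len_area_deriv[OF X] obtain l' where l': "l' < 0"
    "(half_area has_real_derivative l' / curv X) (at X)" .
  \<comment> \<open>Since \<open>curv X * half_len X = half_area X + arccos (c * X)\<close>, the
    twist is a positive combination of two decreasing functions.\<close>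
  have tw: "half_twist = (\<lambda>X. M * (half_area X + arccos (c * X)) + half_area X)"
    by (auto simp: half_twist_def half_area_def fun_eq_iff algebra_simps)
  have pos: "0 < 1 - c\<^sup>2 * X\<^sup>2" using cX X by blast
  note A = arccos_cX_deriv[OF X(1,2)]
  have "DERIV half_twist X :> M * (l' / curv X - c / sqrt (1 - c\<^sup>2 * X\<^sup>2)) + l' / curv X"
    unfolding tw using DERIV_add[OF DERIV_cmult[OF DERIV_add[OF l'(2) A]] l'(2)] by simp
  moreover have "l' / curv X < 0" using l' curv_pos[of X] X by (simp add: divide_neg_pos)
  moreover have "M * (l' / curv X - c / sqrt (1 - c\<^sup>2 * X\<^sup>2)) < 0"
    using calculation(2) c pos M by (intro mult_pos_neg) (auto simp: less_trans[OF _ divide_pos_pos])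
  ultimately show ?thesis by (intro exI conjI) (assumption, linarith)
qed

lemma half_twist_antimono:
  assumes "-1 < a" "a < b" "b \<le> 1 / c"
  shows "half_twist b < half_twist a"
  by (rule strict_antimono_except_point[OF assms(2), where p = 1])
    (use assms half_twist_deriv_neg in \<open>auto intro: continuous_on_subset[OF continuous_on_half_twist]\<close>)

text \<open>The twist is 0 at the straight segment \<open>X = 1 / c\<close> and unbounded near -1,
  where the length blows up while the curvature stays at least 1.\<close>

lemma half_twist_surj:
  assumes "0 < y"
  obtains X where "-1 < X" "X < 1 / c" "half_twist X = y"
proof -
  have c1: "1 < 1 / c" using c c_less_1 by simp
  have 0: "half_twist (1 / c) = 0"
    using c by (simp add: half_twist_def half_area_def curv_def power_divide)
  have "filterlim (\<lambda>X::real. 1 / sqrt (1 - X\<^sup>2)) at_top (at_right (-1))" by real_asymp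
  \<comment> \<open>This threshold makes \<open>M * half_len Y\<close> at least
    \<open>y + pi\<close>; the summand \<open>pi\<close> pays for the angle
    \<open>arccos (c * Y)\<close> subtracted in the area.\<close>
  then have "\<forall>\<^sub>F X in at_right (-1::real). (y + pi) * c / (M * R) \<le> 1 / sqrt (1 - X\<^sup>2)"
    by (simp add: filterlim_at_top)
  then obtain b where b: "-1 < b"
    "\<And>X. -1 < X \<Longrightarrow> X < b \<Longrightarrow> (y + pi) * c / (M * R) \<le> 1 / sqrt (1 - X\<^sup>2)"
    unfolding eventually_at_right_field by blast
  \<comment> \<open>The midpoint of -1 and \<open>min b 0\<close>: it is below \<open>b\<close>, and
    being negative it lies on the trigonometric branch with \<open>arccos Y\<close> at least
    1.\<close>
  define Y where "Y = (min b 0 - 1) / 2"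
  have Y: "-1 < Y" "Y < 0" "Y < b" using b(1) by (auto simp: Y_def)
  have Yc: "Y < 1 / c" using Y c1 by simp
  have cos: "1 \<le> arccos Y"
    using arccos_le_mono[of 0 Y] Y pi_gt3 by simp
  have rt: "0 < sqrt (1 - Y\<^sup>2)" using Y by (simp add: abs_square_less_1)
  have "(y + pi) * c / (M * R) \<le> inv_sinc Y"
  proof -
    have "1 / sqrt (1 - Y\<^sup>2) \<le> arccos Y / sqrt (1 - Y\<^sup>2)"
      using cos rt by (simp add: divide_right_mono)
    then show ?thesis using b(2)[OF Y(1,3)] Y by (simp add: inv_sinc_def)
  qed
  then have L: "(y + pi) / M \<le> half_len Y"
    using M R c by (simp add: half_len_def field_simps)
  have K: "1 \<le> curv Y"
  proof -
    have "Y\<^sup>2 < 1" using Y by (simp add: abs_square_less_1)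
    then have "c\<^sup>2 * Y\<^sup>2 \<le> c\<^sup>2" by (simp add: mult_left_le)
    then have "R\<^sup>2 \<le> 1 - c\<^sup>2 * Y\<^sup>2" using Rc by linarith
    then have "R \<le> sqrt (1 - c\<^sup>2 * Y\<^sup>2)" by (rule real_le_rsqrt)
    then show ?thesis using R by (simp add: curv_def)
  qed
  have "half_len Y \<le> curv Y * half_len Y"
    using K half_len_pos[OF Y(1)] by simp
  moreover have "y + pi \<le> M * half_len Y" using L M by (simp add: field_simps)
  moreover have "M * half_len Y \<le> M * (curv Y * half_len Y)" using calculation M by simp
  moreover have "arccos (c * Y) \<le> pi" using cX[OF Y(1) Yc] by (simp add: arccos_ubound)
  ultimately have "y \<le> half_twist Y"
    using half_len_pos[OF Y(1)] unfolding half_twist_def half_area_def mult.assoc by linarith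
  moreover have "continuous_on {Y..1 / c} half_twist"
    by (rule continuous_on_subset[OF continuous_on_half_twist]) (use Y in auto)
  ultimately have "\<exists>x\<ge>Y. x \<le> 1 / c \<and> half_twist x = y"
    using 0 assms Yc by (intro IVT2') auto
  then obtain X where X: "Y \<le> X" "X \<le> 1 / c" "half_twist X = y"
    by auto
  moreover have "X \<noteq> 1 / c" using X 0 assms by auto
  ultimately show ?thesis using that[of X] Y by auto
qed

section \<open>Isoperimetric comparison with multiple covers\<close>

lemma curv_sq: "R\<^sup>2 * (curv X)\<^sup>2 = 1 - c\<^sup>2 * X\<^sup>2" if "-1 < X" "X < 1 / c"
  using cX(3)[OF that] R by (simp add: curv_def power_divide)

text \<open>Here \<open>c * sin u / R\<close> is the frequency \<omega> of the elliptic arc, so this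
  is \<kappa>^2 = 1 + \<omega>^2.\<close>

lemma curv_cos:
  assumes "0 < sin u"
  shows "curv (cos u) = sqrt (1 + (c * sin u / R)\<^sup>2)"
proof -
  have "1 + (c * sin u / R)\<^sup>2 = (1 - c\<^sup>2 * (cos u)\<^sup>2) / R\<^sup>2"
    using R Rc unfolding power_divide power_mult_distrib sin_squared_eq
    by (simp add: divide_simps) algebra
  then show ?thesis using R by (simp add: curv_def real_sqrt_divide)
qed

text \<open>The slope of \<open>sqrt (1 + x^2)\<close> is at most 1. For frequencies
  \<open>a\<close> and \<open>b\<close> this bounds a difference of curvatures; times the common
  half length, it bounds the difference of curvature times length by the difference of the angles
  \<omega> L / 2.\<close>

lemma sqrt_one_plus_sq_diff_le:
  assumes "0 \<le> a" "a \<le> (b::real)"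
  shows "sqrt (1 + b\<^sup>2) - sqrt (1 + a\<^sup>2) \<le> b - a"
proof -
  have "a \<le> sqrt (1 + a\<^sup>2)" using assms by (simp add: real_le_rsqrt)
  then have "(b - a) * a \<le> (b - a) * sqrt (1 + a\<^sup>2)" using assms by (intro mult_left_mono) auto
  then have "1 + b\<^sup>2 \<le> (sqrt (1 + a\<^sup>2) + (b - a))\<^sup>2"
    by (simp add: power2_sum) (simp add: power2_eq_square algebra_simps)
  then have "sqrt (1 + b\<^sup>2) \<le> sqrt (1 + a\<^sup>2) + (b - a)"
    using assms by (intro real_le_lsqrt) auto
  then show ?thesis by simp
qed

text \<open>The derivative \<open>1 / sqrt (1 - x^2) - c / sqrt (1 - c^2 x^2)\<close> is positive
  because \<open>c < 1\<close>. The two terms are the argument of C + i \<kappa> S at the end of an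
  arc and the angle \<open>u\<close> with \<open>cos u = x\<close>.\<close>

lemma arccos_diff_mono:
  assumes "-1 < a" "a < b" "b < 1"
  shows "arccos (c * a) - arccos a < arccos (c * b) - arccos b"
proof (rule DERIV_pos_imp_increasing_open[OF assms(2)])
  have c1: "1 < 1 / c" using c c_less_1 by simp
  have cx: "-1 < c * x" "c * x < 1" "0 < 1 - c\<^sup>2 * x\<^sup>2" if "-1 < x" "x < 1" for x
    using cX[of x] that c1 by auto
  show "continuous_on {a..b} (\<lambda>x. arccos (c * x) - arccos x)"
    using assms cx by (intro continuous_intros) (auto simp: less_imp_le)
  fix x assume x: "a < x" "x < b"
  then have x1: "-1 < x" "x < 1" using assms by auto
  then have x2: "0 < 1 - x\<^sup>2" by (simp add: abs_square_less_1)
  have "((\<lambda>x. arccos (c * x) - arccos x) has_real_derivative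
      1 / sqrt (1 - x\<^sup>2) - c / sqrt (1 - c\<^sup>2 * x\<^sup>2)) (at x)"
    using cx[OF x1] x1
    by (auto intro!: derivative_eq_intros simp: power_mult_distrib field_simps)
  moreover have "c / sqrt (1 - c\<^sup>2 * x\<^sup>2) < 1 / sqrt (1 - x\<^sup>2)"
  proof -
    have "c\<^sup>2 * (1 - x\<^sup>2) < 1 - c\<^sup>2 * x\<^sup>2"
      using Rc R by (simp add: algebra_simps) (smt (verit) zero_less_power)
    then have "sqrt (c\<^sup>2 * (1 - x\<^sup>2)) < sqrt (1 - c\<^sup>2 * x\<^sup>2)" by simp
    then have "c * sqrt (1 - x\<^sup>2) < sqrt (1 - c\<^sup>2 * x\<^sup>2)"
      using c by (simp add: real_sqrt_mult)
    then show ?thesis using cx[OF x1] x2 by (simp add: divide_simps)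
  qed
  ultimately show "\<exists>y. ((\<lambda>x. arccos (c * x) - arccos x) has_real_derivative y) (at x) \<and> 0 < y"
    by (intro exI conjI) (assumption, linarith)
qed

text \<open>A multiple arc has turned further than any simple one, so equal twist forces its
  curvature times length to be larger. This suffices unless its half length \<open>B\<close> is the
  smaller one. In that case the simple arc of half length \<open>B\<close> sweeps at least as much
  area, and moving from it to \<open>X\<close> lowers the functional \<open>G\<close>.\<close>

lemma multiple_cover_longer:
  assumes u: "0 < u" "u < pi" and m: "1 \<le> (m::nat)"
    and B: "B = R / c * ((u + m * pi) / sin u)"
    and \<theta>: "\<theta> = arccos (c * cos u) + m * pi"
    and tw: "(M + 1) * (curv (cos u) * B) - \<theta> = half_twist X" and X: "-1 < X" "X < 1 / c"
  shows "(half_len X)\<^sup>2 + M * (curv X * half_len X)\<^sup>2 < B\<^sup>2 + M * (curv (cos u) * B)\<^sup>2"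
proof -
  have su: "0 < sin u" using u sin_gt_zero by simp
  have cu: "-1 < cos u" "cos u < 1"
    using u cos_monotone_0_pi[of 0 u] cos_monotone_0_pi[of u pi] by auto
  have c1: "1 < 1 / c" using c c_less_1 by simp
  have Bpos: "0 < B" using B u su R c m by (simp add: add_pos_nonneg)
  have mpi: "pi \<le> m * pi" using m by simp
  have "0 < arccos (c * cos u)" using cX[of "cos u"] cu c1 arccos_lt_bounded[of "c * cos u"] by simp
  then have "arccos (c * X) < \<theta>"
    using cX[OF X] arccos_ubound[of "c * X"] mpi \<theta> by linarith
  then have "(M + 1) * (curv X * half_len X) < (M + 1) * (curv (cos u) * B)"
    using tw by (simp add: half_twist_def half_area_def algebra_simps)
  then have K: "curv X * half_len X < curv (cos u) * B" using M by simp
  have Kpos: "0 < curv X * half_len X" using curv_pos[OF X] half_len_pos X by simp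
  have K2: "M * (curv X * half_len X)\<^sup>2 < M * (curv (cos u) * B)\<^sup>2"
    using K Kpos M by (simp add: power_strict_mono)
  show ?thesis
  proof (cases "half_len X \<le> B")
    case True
    then have "(half_len X)\<^sup>2 \<le> B\<^sup>2" using half_len_pos[OF X(1)] by (simp add: power_mono)
    then show ?thesis using K2 by simp
  next
    case False
    \<comment> \<open>Without its circuits the arc is shorter than \<open>B\<close>, while
      \<open>half_len X\<close> exceeds \<open>B\<close>; so a simple arc between the two has half
      length exactly \<open>B\<close>.\<close>
    have Bu: "half_len (cos u) < B"
      using inv_sinc_cos[OF u] su R c m by (simp add: half_len_def B divide_strict_right_mono)
    then have Xu: "X < cos u"
      using half_len_antimono[of "cos u" X] False cu by (cases "X = cos u") force+
    have "continuous_on {X..cos u} half_len"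
      by (rule continuous_on_subset[OF continuous_on_half_len]) (use X in auto)
    then have "\<exists>x\<ge>X. x \<le> cos u \<and> half_len x = B"
      using Bu False Xu by (intro IVT2') auto
    then obtain X' where X': "X \<le> X'" "X' \<le> cos u" "half_len X' = B"
      by auto
    moreover have "X \<noteq> X'" "X' \<noteq> cos u" using X'(3) Bu False by auto
    ultimately have X'2: "X < X'" "X' < cos u" by auto
    have X'3: "-1 < X'" "X' < 1" "X' < 1 / c" using X'2 X cu c1 by auto
    define v where "v = arccos X'"
    have v: "0 < v" "v < pi" "cos v = X'" using X'3 arccos_lt_bounded[of X'] by (auto simp: v_def)
    have sv: "0 < sin v" using v sin_gt_zero by simp
    have Bv: "B = R / c * (v / sin v)" 
      using inv_sinc_cos[OF v(1,2)] by (simp add: half_len_def flip: X'(3) v(3))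
    \<comment> \<open>The frequencies of the two arcs of half length \<open>B\<close>: times
      \<open>B\<close> they are the angles \<open>v\<close> and \<open>u + m * pi\<close>.\<close>
    define a where "a = c * sin v / R"
    define b where "b = c * sin u / R"
    have aB: "a * B = v" using R c sv by (simp add: a_def Bv)
    have bB: "b * B = u + m * pi" using R c su by (simp add: b_def B)
    have ab: "a \<le> b" "0 \<le> a"
    proof -
      have "a * B \<le> b * B" using aB bB u v mpi by linarith
      then show "a \<le> b" using Bpos by simp
      show "0 \<le> a" using c sv R by (simp add: a_def)
    qed
    have "B * (curv (cos u) - curv X') \<le> B * (b - a)"
      using sqrt_one_plus_sq_diff_le[OF ab(2,1)] Bpos curv_cos[OF su] curv_cos[OF sv] v
      by (intro mult_left_mono) (auto simp: a_def b_def)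
    also have "\<dots> = u + m * pi - v" using aB bB by (simp add: algebra_simps)
    also have "\<dots> \<le> \<theta> - arccos (c * X')"
      using arccos_diff_mono[OF X'3(1) X'2(2) cu(2)] u arccos_cos[of u] by (simp add: \<theta> v_def)
    finally have area: "curv (cos u) * B - \<theta> \<le> half_area X'"
      by (simp add: half_area_def X'(3) algebra_simps)
    define y where "y = half_twist X"
    have "half_twist X' < y" unfolding y_def using half_twist_antimono[OF X(1) X'2(1)] X'3 by simp
    moreover have "0 < M * curv X' * half_len X'"
      using M curv_pos half_len_pos X'3 by simp
    \<comment> \<open>Positivity is what permits squaring the bound \<open>MK\<close> below.\<close>
    ultimately have y': "0 < y - half_area X'" by (simp add: half_twist_def)
    have "M * (curv (cos u) * B) = y - (curv (cos u) * B - \<theta>)"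
      using tw by (simp add: y_def algebra_simps)
    then have MK: "y - half_area X' \<le> M * (curv (cos u) * B)" using area by simp
    \<comment> \<open>The squared half length that a simple base arc would have if its fibre part
      were adjusted to reach the twist \<open>y\<close>. At \<open>X\<close> the adjustment is void.
      Since the area changes at rate 1 / \<kappa> with the length, the derivative of
      \<open>G\<close> has the sign of \<open>y - half_twist x\<close>.\<close>
    define G where "G = (\<lambda>x. (half_len x)\<^sup>2 + (y - half_area x)\<^sup>2 / M)"
    have "G X < G X'"
    proof (rule DERIV_pos_imp_increasing_open[OF X'2(1)])
      show "continuous_on {X..X'} G"
        unfolding G_def
        by (intro continuous_intros continuous_on_subset[OF continuous_on_half_len]
            continuous_on_subset[OF continuous_on_half_area]) (use X X'3 M in auto)
      fix x assume x: "X < x" "x < X'"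
      then have x1: "-1 < x" "x < 1 / c" "x \<noteq> 1" using X X'3 by auto
      from half_len_area_deriv[OF x1] obtain l' where l': "(half_len has_real_derivative l') (at x)"
        "l' < 0" "(half_area has_real_derivative l' / curv x) (at x)" .
      have cp: "0 < curv x" using curv_pos x1 by simp
      have "DERIV G x :> 2 * half_len x * l' - 2 * (y - half_area x) * (l' / curv x) / M"
        unfolding G_def using M by (auto intro!: derivative_eq_intros l')
      moreover have "2 * half_len x * l' - 2 * (y - half_area x) * (l' / curv x) / M
          = (2 * l' / (M * curv x)) * (half_twist x - y)"
      proof -
        have "2 * half_len x * l' - 2 * (y - half_area x) * (l' / curv x) / M
            = (2 * l' / (M * curv x)) * (M * curv x * half_len x - (y - half_area x))"
          using M cp by (simp add: field_simps)
        then show ?thesis by (simp add: half_twist_def)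
      qed
      moreover have "half_twist x < y"
        unfolding y_def using half_twist_antimono[OF X(1) x(1)] x1 by simp
      then have "0 < (2 * l' / (M * curv x)) * (half_twist x - y)"
        using l' M cp by (intro mult_neg_neg) (auto simp: divide_neg_pos)
      ultimately show "\<exists>z. DERIV G x :> z \<and> 0 < z" by metis
    qed
    moreover have "G X = (half_len X)\<^sup>2 + M * (curv X * half_len X)\<^sup>2"
    proof -
      have "y - half_area X = M * (curv X * half_len X)" by (simp add: y_def half_twist_def)
      then show ?thesis using M by (simp add: G_def power2_eq_square)
    qed
    moreover have "G X' \<le> B\<^sup>2 + M * (curv (cos u) * B)\<^sup>2"
    proof -
      have "(y - half_area X')\<^sup>2 \<le> (M * (curv (cos u) * B))\<^sup>2" using MK y' by (intro power_mono) auto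
      then have "(y - half_area X')\<^sup>2 / M \<le> (M * (curv (cos u) * B))\<^sup>2 / M"
        using M by (simp add: divide_right_mono)
      also have "\<dots> = M * (curv (cos u) * B)\<^sup>2" using M by (simp add: power2_eq_square)
      finally show ?thesis by (simp add: G_def X'(3))
    qed
    ultimately show ?thesis by simp
  qed
qed

end

subsection \<open>The comparison functions of circular arcs\<close>

definition rate :: "real \<Rightarrow> real" where
  "rate \<kappa> = sqrt \<bar>1 - \<kappa>\<^sup>2\<bar>"

definition sn :: "real \<Rightarrow> real \<Rightarrow> real" where
  "sn \<kappa> t = (if \<kappa>\<^sup>2 < 1 then sinh (rate \<kappa> * t / 2) / rate \<kappa>
     else if \<kappa>\<^sup>2 = 1 then t / 2 else sin (rate \<kappa> * t / 2) / rate \<kappa>)"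

definition cs :: "real \<Rightarrow> real \<Rightarrow> real" where
  "cs \<kappa> t = (if \<kappa>\<^sup>2 < 1 then cosh (rate \<kappa> * t / 2)
     else if \<kappa>\<^sup>2 = 1 then 1 else cos (rate \<kappa> * t / 2))"

lemma sn_elliptic: "1 < \<kappa> \<Longrightarrow> sn \<kappa> t = sin (rate \<kappa> * t / 2) / rate \<kappa>"
  and cs_elliptic: "1 < \<kappa> \<Longrightarrow> cs \<kappa> t = cos (rate \<kappa> * t / 2)"
  using one_less_power[of \<kappa> 2] unfolding sn_def cs_def by (smt (verit) pos2)+

lemma rate_sq: "(rate \<kappa>)\<^sup>2 = \<bar>1 - \<kappa>\<^sup>2\<bar>"
  by (simp add: rate_def)

lemma rate_pos: "\<kappa>\<^sup>2 \<noteq> 1 \<Longrightarrow> 0 < rate \<kappa>"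
  by (simp add: rate_def)

lemma sn_0 [simp]: "sn \<kappa> 0 = 0" and cs_0 [simp]: "cs \<kappa> 0 = 1"
  by (simp_all add: sn_def cs_def)

lemma sn_deriv [derivative_intros]:
  "(sn \<kappa> has_real_derivative cs \<kappa> t / 2) (at t within A)"
proof -
  consider "\<kappa>\<^sup>2 < 1" | "\<kappa>\<^sup>2 = 1" | "\<kappa>\<^sup>2 > 1" by linarith
  then show ?thesis
  proof cases
    case 1
    then show ?thesis using rate_pos[of \<kappa>]
      unfolding sn_def[abs_def] cs_def
      by (auto intro!: derivative_eq_intros)
  next
    case 3
    then show ?thesis using rate_pos[of \<kappa>]
      unfolding sn_def[abs_def] cs_def
      by (auto intro!: derivative_eq_intros)
  qed (auto simp: sn_def[abs_def] cs_def intro!: derivative_eq_intros)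
qed

lemma cs_deriv [derivative_intros]:
  "(cs \<kappa> has_real_derivative (1 - \<kappa>\<^sup>2) * sn \<kappa> t / 2) (at t within A)"
proof -
  consider "\<kappa>\<^sup>2 < 1" | "\<kappa>\<^sup>2 = 1" | "\<kappa>\<^sup>2 > 1" by linarith
  then show ?thesis
  proof cases
    case 1
    have "rate \<kappa> * rate \<kappa> = 1 - \<kappa>\<^sup>2" using 1 rate_sq[of \<kappa>] by (simp add: power2_eq_square)
    then have "(1 - \<kappa>\<^sup>2) / rate \<kappa> = rate \<kappa>" using 1 rate_pos[of \<kappa>] by (simp add: field_simps)
    then have "rate \<kappa> * sinh (rate \<kappa> * t / 2) / 2 = (1 - \<kappa>\<^sup>2) * (sinh (rate \<kappa> * t / 2) / rate \<kappa>) / 2"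
      by (metis times_divide_eq_left times_divide_eq_right)
    then show ?thesis using 1
      unfolding sn_def cs_def[abs_def]
      by (auto intro!: derivative_eq_intros simp: mult.commute)
  next
    case 3
    have "rate \<kappa> * rate \<kappa> = \<kappa>\<^sup>2 - 1" using 3 rate_sq[of \<kappa>] by (simp add: power2_eq_square)
    then have "(\<kappa>\<^sup>2 - 1) / rate \<kappa> = rate \<kappa>" using 3 rate_pos[of \<kappa>] by (simp add: field_simps)
    then have "- rate \<kappa> * sin (rate \<kappa> * t / 2) / 2 = (1 - \<kappa>\<^sup>2) * (sin (rate \<kappa> * t / 2) / rate \<kappa>) / 2"
      by (metis minus_diff_eq mult_minus_left times_divide_eq_left times_divide_eq_right)
    then show ?thesis using 3
      unfolding sn_def cs_def[abs_def]
      by (auto intro!: derivative_eq_intros simp: mult.commute)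
  qed (auto simp: sn_def cs_def[abs_def])
qed

text \<open>The conserved quantity of the linear system for \<open>sn\<close> and \<open>cs\<close>.
  It gives \<open>cs \<kappa> t + i \<kappa> sn \<kappa> t\<close> the squared modulus
  \<open>1 + (sn \<kappa> t)^2\<close> for every \<kappa>, so the geometry below needs no
  distinction of types.\<close>

lemma cs_sq: "(cs \<kappa> t)\<^sup>2 = 1 + (1 - \<kappa>\<^sup>2) * (sn \<kappa> t)\<^sup>2"
proof -
  consider "\<kappa>\<^sup>2 < 1" | "\<kappa>\<^sup>2 = 1" | "\<kappa>\<^sup>2 > 1" by linarith
  then show ?thesis
  proof cases
    case 1
    then show ?thesis using rate_sq[of \<kappa>]
      by (simp add: sn_def cs_def power_divide cosh_square_eq)
  next
    case 3
    then have "(\<kappa>\<^sup>2 - 1) * (sn \<kappa> t)\<^sup>2 = (sin (rate \<kappa> * t / 2))\<^sup>2" using rate_sq[of \<kappa>]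
      by (simp add: sn_def power_divide)
    then show ?thesis using 3
      by (simp add: cs_def cos_squared_eq algebra_simps)
  qed (auto simp: sn_def cs_def)
qed

lemma continuous_on_sn [continuous_intros]: "continuous_on A (sn \<kappa>)"
  and continuous_on_cs [continuous_intros]: "continuous_on A (cs \<kappa>)"
  by (meson DERIV_continuous_on sn_deriv) (meson DERIV_continuous_on cs_deriv)

text \<open>The continuous argument of \<open>cs \<kappa> t + i \<kappa> sn \<kappa> t\<close>.\<close>

definition turn :: "real \<Rightarrow> real \<Rightarrow> real" where
  "turn \<kappa> t = \<kappa> * integral {0..t} (\<lambda>r. 1 / (2 * (1 + (sn \<kappa> r)\<^sup>2)))"

lemma one_plus_sq_pos: "0 < 1 + (x::real)\<^sup>2"
  by (simp add: add_pos_nonneg)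

lemma one_plus_sq_neq_0 [simp]: "1 + (x::real)\<^sup>2 \<noteq> 0"
  using one_plus_sq_pos[of x] by simp

lemma two_plus_sq [simp]: "2 + 2 * (x::real)\<^sup>2 \<noteq> 0" "\<not> 2 + 2 * x\<^sup>2 < 0" "\<not> 1 + x\<^sup>2 < 0"
  using one_plus_sq_pos[of x] by linarith+

lemma continuous_on_turn_integrand: "continuous_on A (\<lambda>r. 1 / (2 * (1 + (sn \<kappa> r)\<^sup>2)))"
  by (intro continuous_intros) auto

lemma turn_0 [simp]: "turn \<kappa> 0 = 0"
  by (simp add: turn_def)

lemma turn_deriv_within:
  assumes "t \<in> {0..T}"
  shows "(turn \<kappa> has_real_derivative \<kappa> / (2 * (1 + (sn \<kappa> t)\<^sup>2))) (at t within {0..T})"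
  using DERIV_cmult[OF integral_has_real_derivative[OF continuous_on_turn_integrand assms], of \<kappa>]
  by (simp add: turn_def[abs_def])

lemma turn_deriv:
  assumes "0 < t"
  shows "(turn \<kappa> has_real_derivative \<kappa> / (2 * (1 + (sn \<kappa> t)\<^sup>2))) (at t)"
  using turn_deriv_within[of t "t + 1" \<kappa>] assms at_within_Icc_at[of 0 t "t + 1"] by simp

lemma continuous_on_turn: "continuous_on {0..T} (turn \<kappa>)"
  by (meson DERIV_continuous_on turn_deriv_within)

text \<open>Serves to read the sign of \<kappa> off the twist: the factor of \<kappa> in
  \<open>(M + 1) * \<kappa> * t - 2 * turn \<kappa> t\<close> is then at least
  \<open>M * t\<close>.\<close>

lemma turn_bounds:
  assumes "0 \<le> t"
  obtains J where "turn \<kappa> t = \<kappa> * J" "0 \<le> J" "J \<le> t / 2"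
proof
  have int: "(\<lambda>r. 1 / (2 * (1 + (sn \<kappa> r)\<^sup>2))) integrable_on {0..t}"
    by (intro integrable_continuous_interval continuous_on_turn_integrand)
  show "turn \<kappa> t = \<kappa> * integral {0..t} (\<lambda>r. 1 / (2 * (1 + (sn \<kappa> r)\<^sup>2)))"
    by (simp add: turn_def)
  show "0 \<le> integral {0..t} (\<lambda>r. 1 / (2 * (1 + (sn \<kappa> r)\<^sup>2)))"
    by (intro integral_nonneg int) (simp add: add_nonneg_nonneg)
  have "integral {0..t} (\<lambda>r. 1 / (2 * (1 + (sn \<kappa> r)\<^sup>2))) \<le> integral {0..t} (\<lambda>r. 1 / 2)"
    by (intro integral_le int) (auto simp: divide_simps one_plus_sq_pos)
  then show "integral {0..t} (\<lambda>r. 1 / (2 * (1 + (sn \<kappa> r)\<^sup>2))) \<le> t / 2"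
    using assms by simp
qed

lemma sin_turn_aux:
  "1 - (cs \<kappa> t / sqrt (1 + (sn \<kappa> t)\<^sup>2))\<^sup>2 = (\<kappa> * sn \<kappa> t)\<^sup>2 / (1 + (sn \<kappa> t)\<^sup>2)"
  using one_plus_sq_pos[of "sn \<kappa> t"]
  by (simp add: power_divide divide_simps cs_sq) (simp add: algebra_simps)

lemma cs_quot_bounds: "\<bar>cs \<kappa> t / sqrt (1 + (sn \<kappa> t)\<^sup>2)\<bar> \<le> 1"
proof -
  have "0 \<le> (\<kappa> * sn \<kappa> t)\<^sup>2 / (1 + (sn \<kappa> t)\<^sup>2)" using one_plus_sq_pos[of "sn \<kappa> t"] by simp
  then have "(cs \<kappa> t / sqrt (1 + (sn \<kappa> t)\<^sup>2))\<^sup>2 \<le> 1" unfolding sin_turn_aux[symmetric] by simp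
  then show ?thesis by (simp add: abs_square_le_1)
qed

lemma cs_quot_deriv:
  "((\<lambda>t. cs \<kappa> t / sqrt (1 + (sn \<kappa> t)\<^sup>2)) has_real_derivative
     - (\<kappa>\<^sup>2 * sn \<kappa> t / (2 * (1 + (sn \<kappa> t)\<^sup>2) * sqrt (1 + (sn \<kappa> t)\<^sup>2)))) (at t)"
proof -
  define S C q where "S = sn \<kappa> t" and "C = cs \<kappa> t" and "q = sqrt (1 + S\<^sup>2)"
  have q: "0 < q" "q * q = 1 + S\<^sup>2" "q\<^sup>2 = 1 + S\<^sup>2"
    using one_plus_sq_pos[of S] by (auto simp: q_def)
  have "((\<lambda>t. cs \<kappa> t / sqrt (1 + (sn \<kappa> t)\<^sup>2)) has_real_derivative
     ((1 - \<kappa>\<^sup>2) * S / 2 * q - C * (2 * S * (C / 2) * (1 / (2 * q)))) / (q * q)) (at t)"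
    unfolding S_def C_def q_def
    by (auto intro!: derivative_eq_intros simp: one_plus_sq_pos divide_simps)
  moreover have "((1 - \<kappa>\<^sup>2) * S / 2 * q - C * (2 * S * (C / 2) * (1 / (2 * q)))) / (q * q)
      = S * ((1 - \<kappa>\<^sup>2) * q\<^sup>2 - C\<^sup>2) / (2 * q\<^sup>2 * q)"
    using q(1) by (simp add: field_simps power2_eq_square)
  moreover have "(1 - \<kappa>\<^sup>2) * q\<^sup>2 - C\<^sup>2 = - \<kappa>\<^sup>2"
    unfolding q(3) C_def S_def cs_sq by (simp add: algebra_simps)
  ultimately show ?thesis
    by (simp add: q(3) flip: S_def q_def) (simp add: q_def S_def mult.commute)
qed

text \<open>Both sides have derivative \<open>\<kappa> / (2 (1 + S^2))\<close> as long as
  \<open>sn\<close> is positive; past its first zero the arccosine turns back. Positivity on the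
  open interval only allows \<open>T\<close> to be that zero, as for a complete circuit.\<close>

lemma turn_eq_arccos:
  assumes "0 < \<kappa>" "0 \<le> T" and pos: "\<And>t. 0 < t \<Longrightarrow> t < T \<Longrightarrow> 0 < sn \<kappa> t"
  shows "turn \<kappa> T = arccos (cs \<kappa> T / sqrt (1 + (sn \<kappa> T)\<^sup>2))"
proof (cases "T = 0")
  case False
  then have T: "0 < T" using assms by simp
  let ?q = "\<lambda>t. cs \<kappa> t / sqrt (1 + (sn \<kappa> t)\<^sup>2)"
  have "turn \<kappa> T - arccos (?q T) = turn \<kappa> 0 - arccos (?q 0)"
  proof (rule DERIV_isconst_end[OF T])
    have "-1 \<le> ?q x \<and> ?q x \<le> 1" for x using cs_quot_bounds[of \<kappa> x] by linarith
    then show "continuous_on {0..T} (\<lambda>t. turn \<kappa> t - arccos (?q t))"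
      by (intro continuous_intros continuous_on_turn) (auto simp: one_plus_sq_pos)
    fix t assume t: "0 < t" "t < T"
    define S q where "S = sn \<kappa> t" and "q = sqrt (1 + S\<^sup>2)"
    have S: "0 < S" using pos t by (simp add: S_def)
    have q: "0 < q" "q\<^sup>2 = 1 + S\<^sup>2"
      using one_plus_sq_pos[of S] by (auto simp: q_def)
    have "0 < (\<kappa> * S)\<^sup>2 / (1 + S\<^sup>2)" using S assms(1) one_plus_sq_pos[of S] by simp
    then have "(?q t)\<^sup>2 < 1" using sin_turn_aux[of \<kappa> t] by (simp add: S_def)
    then have "\<bar>?q t\<bar> < 1" by (rule iffD1[OF abs_square_less_1])
    then have "-1 < ?q t" "?q t < 1" by linarith+
    then have "DERIV (\<lambda>t. arccos (?q t)) t :>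
        inverse (- sqrt (1 - (?q t)\<^sup>2)) * - (\<kappa>\<^sup>2 * S / (2 * (1 + S\<^sup>2) * q))"
      unfolding S_def q_def by (intro DERIV_chain2[OF DERIV_arccos cs_quot_deriv])
    moreover have "sqrt (1 - (?q t)\<^sup>2) = \<kappa> * S / q"
      unfolding sin_turn_aux using S assms(1) by (simp add: real_sqrt_divide q_def S_def)
    moreover have "inverse (- (\<kappa> * S / q)) * - (\<kappa>\<^sup>2 * S / (2 * (1 + S\<^sup>2) * q)) = \<kappa> / (2 * (1 + S\<^sup>2))"
      using S q(1) assms(1) by (simp add: divide_simps power2_eq_square)
    ultimately have "DERIV (\<lambda>t. arccos (?q t)) t :> \<kappa> / (2 * (1 + S\<^sup>2))" by simp
    from DERIV_diff[OF turn_deriv[OF t(1), of \<kappa>] this]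
    show "DERIV (\<lambda>t. turn \<kappa> t - arccos (?q t)) t :> 0" by (simp add: S_def)
  qed
  then show ?thesis by simp
qed simp

text \<open>Like \<open>sn\<close>, also \<open>cs\<close> changes sign after this time, so the base
  curve, a quotient of expressions in both, closes up: half a period of \<open>sn\<close> is one
  full revolution of the dipole circle.\<close>

lemma sn_add_half_period:
  assumes "1 < \<kappa>"
  shows "sn \<kappa> (t + 2 * pi / rate \<kappa>) = - sn \<kappa> t"
proof -
  have k: "1 < \<kappa>\<^sup>2" using assms by simp
  then have "rate \<kappa> * (t + 2 * pi / rate \<kappa>) / 2 = rate \<kappa> * t / 2 + pi"
    using rate_pos[of \<kappa>] by (simp add: field_simps)
  then have "sin (rate \<kappa> * (t + 2 * pi / rate \<kappa>) / 2) = - sin (rate \<kappa> * t / 2)"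
    by (simp only: sin_periodic_pi)
  then show ?thesis using k unfolding sn_def by simp
qed

lemma sn_pos:
  assumes "1 < \<kappa>" "0 < t" "rate \<kappa> * t / 2 < pi"
  shows "0 < sn \<kappa> t"
proof -
  have k: "1 < \<kappa>\<^sup>2" using assms by simp
  then show ?thesis using rate_pos[of \<kappa>] assms sin_gt_zero[of "rate \<kappa> * t / 2"] by (simp add: sn_def)
qed

lemma turn_half_period:
  assumes "1 < \<kappa>"
  shows "turn \<kappa> (2 * pi / rate \<kappa>) = pi"
proof -
  have k: "1 < \<kappa>\<^sup>2" using assms by simp
  then have r: "0 < rate \<kappa>" by (simp add: rate_pos)
  have "0 < sn \<kappa> t" if "0 < t" "t < 2 * pi / rate \<kappa>" for t
    using that r by (intro sn_pos assms) (auto simp: field_simps)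
  then have "turn \<kappa> (2 * pi / rate \<kappa>) = arccos (cs \<kappa> (2 * pi / rate \<kappa>) / sqrt (1 + (sn \<kappa> (2 * pi / rate \<kappa>))\<^sup>2))"
    using assms r by (intro turn_eq_arccos) auto
  moreover have "sn \<kappa> (2 * pi / rate \<kappa>) = 0" "cs \<kappa> (2 * pi / rate \<kappa>) = -1"
    using k r by (simp_all add: sn_def cs_def)
  ultimately show ?thesis by simp
qed

lemma turn_add_half_period:
  assumes "1 < \<kappa>" "0 \<le> t"
  shows "turn \<kappa> (t + 2 * pi / rate \<kappa>) = turn \<kappa> t + pi"
proof (cases "t = 0")
  case True
  then show ?thesis using turn_half_period[OF assms(1)] by simp
next
  case False
  then have t: "0 < t" using assms by simp
  have k: "1 < \<kappa>\<^sup>2" using assms by simp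
  then have r: "0 < 2 * pi / rate \<kappa>" by (simp add: rate_pos)
  let ?P = "2 * pi / rate \<kappa>"
  have "turn \<kappa> (t + ?P) - turn \<kappa> t = turn \<kappa> (0 + ?P) - turn \<kappa> 0"
  proof (rule DERIV_isconst_end[OF t])
    have "continuous_on {0..t} (\<lambda>x. turn \<kappa> (x + ?P))"
      by (rule continuous_on_compose2[OF continuous_on_turn[of "t + ?P"]])
        (use r in \<open>auto intro!: continuous_intros simp: add_nonneg_nonneg\<close>)
    then show "continuous_on {0..t} (\<lambda>x. turn \<kappa> (x + ?P) - turn \<kappa> x)"
      by (intro continuous_intros continuous_on_turn)
    fix x assume x: "0 < x" "x < t"
    have "DERIV (\<lambda>x. turn \<kappa> (x + ?P)) x :> \<kappa> / (2 * (1 + (sn \<kappa> (x + ?P))\<^sup>2))"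
      using turn_deriv[of "x + ?P" \<kappa>] x r by (simp add: DERIV_shift add_pos_pos)
    from DERIV_diff[OF this turn_deriv[OF x(1), of \<kappa>]]
    show "DERIV (\<lambda>x. turn \<kappa> (x + ?P) - turn \<kappa> x) x :> 0"
      by (simp add: sn_add_half_period[OF assms(1)])
  qed
  then show ?thesis using turn_half_period[OF assms(1)] by simp
qed

lemma turn_add_half_periods:
  assumes "1 < \<kappa>" "0 \<le> t"
  shows "turn \<kappa> (t + real m * (2 * pi / rate \<kappa>)) = turn \<kappa> t + m * pi"
    and "(sn \<kappa> (t + real m * (2 * pi / rate \<kappa>)))\<^sup>2 = (sn \<kappa> t)\<^sup>2"
proof (induction m)
  case (Suc m)
  have k: "1 < \<kappa>\<^sup>2" using assms by simp
  then have nn: "0 \<le> t + real m * (2 * pi / rate \<kappa>)"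
    using assms by (simp add: rate_def)
  have eq: "t + real (Suc m) * P = t + real m * P + P" for P by (simp add: distrib_right)
  from turn_add_half_period[OF assms(1) nn]
    sn_add_half_period[OF assms(1), of "t + real m * (2 * pi / rate \<kappa>)"] Suc
  show "turn \<kappa> (t + real (Suc m) * (2 * pi / rate \<kappa>)) = turn \<kappa> t + Suc m * pi"
    "(sn \<kappa> (t + real (Suc m) * (2 * pi / rate \<kappa>)))\<^sup>2 = (sn \<kappa> t)\<^sup>2"
    unfolding eq by (simp_all add: distrib_right)
qed simp_all

section \<open>Arcs ending on the target circle\<close>

context target
begin

lemma sqrt_one_plus_end: "(sn \<kappa> T)\<^sup>2 = (R / c)\<^sup>2 \<Longrightarrow> sqrt (1 + (sn \<kappa> T)\<^sup>2) = 1 / c"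
proof -
  assume a: "(sn \<kappa> T)\<^sup>2 = (R / c)\<^sup>2"
  have "1 + (R / c)\<^sup>2 = (1 / c)\<^sup>2" using Rc c by (simp add: power_divide field_simps)
  then show ?thesis using a c by simp
qed

lemma curv_eq:
  assumes "(sn \<kappa> T)\<^sup>2 = (R / c)\<^sup>2" "0 < \<kappa>" "X\<^sup>2 = (cs \<kappa> T)\<^sup>2"
  shows "curv X = \<kappa>"
proof -
  have "c\<^sup>2 * X\<^sup>2 = c\<^sup>2 + (1 - \<kappa>\<^sup>2) * R\<^sup>2"
    unfolding assms(3) cs_sq assms(1) using c by (simp add: power_divide field_simps)
  then have "1 - c\<^sup>2 * X\<^sup>2 = (R * \<kappa>)\<^sup>2" using Rc by (simp add: algebra_simps power_mult_distrib)
  then show ?thesis using assms(2) R by (simp add: curv_def)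
qed

lemma cs_less:
  assumes "(sn \<kappa> T)\<^sup>2 = (R / c)\<^sup>2" "0 < \<kappa>"
  shows "cs \<kappa> T < 1 / c"
proof -
  have "c\<^sup>2 * (cs \<kappa> T)\<^sup>2 = c\<^sup>2 + (1 - \<kappa>\<^sup>2) * R\<^sup>2"
    using assms c by (simp add: cs_sq power_divide field_simps)
  then have "1 - (c * cs \<kappa> T)\<^sup>2 = (R * \<kappa>)\<^sup>2"
    using Rc by (simp add: algebra_simps power_mult_distrib)
  then have "(c * cs \<kappa> T)\<^sup>2 < 1" using assms(2) R
    by (smt (verit) zero_less_power mult_pos_pos)
  then have "c * cs \<kappa> T < 1" by (simp add: abs_square_less_1)
  then show ?thesis using c by (simp add: field_simps)
qed

text \<open>The parameter is \<open>X = cs \<kappa> T\<close>. The bound by \<open>pi\<close> keeps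
  \<open>sn\<close> positive up to \<open>T\<close>, which selects the root \<open>R / c\<close> of
  the end condition and keeps \<open>turn\<close> within the range of \<open>arccos\<close>.\<close>

lemma arc_end_simple:
  assumes "0 < \<kappa>" "0 < T" and fin: "(sn \<kappa> T)\<^sup>2 = (R / c)\<^sup>2"
    and simple: "1 < \<kappa> \<Longrightarrow> rate \<kappa> * T / 2 < pi"
  obtains X where "-1 < X" "X < 1 / c" "half_len X = T / 2" "curv X = \<kappa>"
    "turn \<kappa> T = arccos (c * X)"
proof
  have cases: "\<kappa>\<^sup>2 < 1 \<or> \<kappa> = 1 \<or> \<kappa>\<^sup>2 > 1 \<and> \<kappa> > 1"
  proof -
    have "\<kappa> > 1" if "\<kappa>\<^sup>2 > 1" using that assms(1) power_le_one[of \<kappa> 2] by force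
    moreover have "\<kappa> = 1" if "\<kappa>\<^sup>2 = 1" using that assms(1) by (simp add: power2_eq_1_iff)
    ultimately show ?thesis by linarith
  qed
  have pos: "0 < sn \<kappa> t" if "0 < t" "t \<le> T" for t
    using cases
  proof (elim disjE conjE)
    assume k: "\<kappa> > 1"
    have "rate \<kappa> * t / 2 \<le> rate \<kappa> * T / 2"
      using that k by (intro divide_right_mono mult_left_mono) (auto simp: rate_def)
    then show ?thesis using sn_pos[OF k that(1)] simple k by simp
  qed (use that rate_pos[of \<kappa>] in \<open>auto simp: sn_def\<close>)
  then have snT: "sn \<kappa> T = R / c"
    using fin assms R c by (simp add: power2_eq_iff_nonneg less_imp_le)
  show "cs \<kappa> T < 1 / c" by (rule cs_less[OF fin assms(1)])
  show "curv (cs \<kappa> T) = \<kappa>" by (rule curv_eq[OF fin assms(1) refl])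
  show "turn \<kappa> T = arccos (c * cs \<kappa> T)"
    using turn_eq_arccos[OF assms(1), of T] pos assms sqrt_one_plus_end[OF fin]
    by (simp add: mult.commute)
  show "-1 < cs \<kappa> T"
    using cases
  proof (elim disjE conjE)
    assume k: "\<kappa>\<^sup>2 > 1" "\<kappa> > 1"
    then have "cos pi < cos (rate \<kappa> * T / 2)"
      using assms simple k by (intro cos_monotone_0_pi) (auto simp: rate_def)
    then show ?thesis by (simp add: cs_elliptic[OF k(2)])
  next
    assume "\<kappa>\<^sup>2 < 1" then show ?thesis using cosh_real_pos[of "rate \<kappa> * T / 2"]
      by (simp add: cs_def less_trans[OF _ cosh_real_pos])
  next
    assume "\<kappa> = 1" then show ?thesis by (simp add: cs_def)
  qed
  show "half_len (cs \<kappa> T) = T / 2"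
    using cases
  proof (elim disjE conjE)
    assume k: "\<kappa>\<^sup>2 > 1" "\<kappa> > 1"
    then have r: "0 < rate \<kappa>" by (intro rate_pos) linarith
    have s: "sin (rate \<kappa> * T / 2) = rate \<kappa> * (R / c)"
      using snT r by (simp add: sn_elliptic[OF k(2)] field_simps)
    have "inv_sinc (cs \<kappa> T) = (rate \<kappa> * T / 2) / (rate \<kappa> * (R / c))"
      using inv_sinc_cos[of "rate \<kappa> * T / 2"] simple k(2) assms r s by (simp add: cs_elliptic)
    then show ?thesis using r R c by (simp add: half_len_def)
  next
    assume k: "\<kappa>\<^sup>2 < 1"
    then have r: "0 < rate \<kappa>" by (intro rate_pos) linarith
    have s: "sinh (rate \<kappa> * T / 2) = rate \<kappa> * (R / c)" using snT k r by (simp add: sn_def field_simps)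
    have "inv_sinc (cs \<kappa> T) = (rate \<kappa> * T / 2) / (rate \<kappa> * (R / c))"
      using inv_sinc_cosh[of "rate \<kappa> * T / 2"] k assms r s by (simp add: cs_def)
    then show ?thesis using r R c by (simp add: half_len_def)
  next
    assume "\<kappa> = 1" then show ?thesis using snT by (simp add: cs_def half_len_def inv_sinc_def sn_def)
  qed
qed

text \<open>Division of the angle \<open>rate \<kappa> * T / 2\<close> by \<open>pi\<close>, with
  the number of revolutions \<open>m\<close> as quotient and \<open>u\<close> as remainder. The
  remainder is not 0, because after whole revolutions the base curve is back at 0 and not on the
  target circle.\<close>

lemma arc_end_multiple:
  assumes "1 < \<kappa>" "0 < T" and fin: "(sn \<kappa> T)\<^sup>2 = (R / c)\<^sup>2"
    and multiple: "pi \<le> rate \<kappa> * T / 2"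
  obtains u m where "0 < u" "u < pi" "1 \<le> (m::nat)" "T / 2 = R / c * ((u + m * pi) / sin u)"
    "curv (cos u) = \<kappa>" "turn \<kappa> T = arccos (c * cos u) + m * pi"
proof
  define a where "a = rate \<kappa> * T / 2"
  define m where "m = nat \<lfloor>a / pi\<rfloor>"
  define u where "u = a - m * pi"
  define t where "t = 2 * u / rate \<kappa>"
  have k: "1 < \<kappa>\<^sup>2" using assms by simp
  then have r: "0 < rate \<kappa>" using rate_pos[of \<kappa>] by simp
  have a: "1 \<le> a / pi" using multiple by (simp add: a_def)
  then show m: "1 \<le> m" unfolding m_def by linarith
  have "real m \<le> a / pi" "a / pi < real m + 1" using a unfolding m_def by linarith+
  then have u: "0 \<le> u" "u < pi" by (auto simp: u_def field_simps)
  have T: "T = t + real m * (2 * pi / rate \<kappa>)"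
  proof -
    have "rate \<kappa> * T = 2 * u + 2 * m * pi" by (simp add: u_def a_def algebra_simps)
    then show ?thesis using r by (simp add: t_def field_simps)
  qed
  have ut: "u = rate \<kappa> * t / 2" using r by (simp add: t_def)
  have t0: "0 \<le> t" using u r by (simp add: t_def)
  have end_t: "(sn \<kappa> t)\<^sup>2 = (R / c)\<^sup>2"
    using turn_add_half_periods(2)[OF assms(1) t0, of m] fin T by simp
  then have "sn \<kappa> t \<noteq> 0" using R c by auto
  then have tpos: "0 < t" using t0 by (cases "t = 0") auto
  then show upos: "0 < u" using r by (simp add: ut)
  show "u < pi" by fact
  have snt: "0 < sn \<kappa> x" if "0 < x" "x \<le> t" for x
  proof (rule sn_pos[OF assms(1) that(1)])
    have "rate \<kappa> * x \<le> rate \<kappa> * t" using that r by simp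
    then show "rate \<kappa> * x / 2 < pi" using u ut by linarith
  qed
  then have sn_t: "sn \<kappa> t = R / c"
    using end_t tpos R c by (simp add: power2_eq_iff_nonneg less_imp_le)
  have cs_t: "cs \<kappa> t = cos u" using k by (simp add: cs_def ut)
  have su: "sin u = rate \<kappa> * (R / c)" using sn_t k r by (simp add: sn_def ut field_simps)
  show "curv (cos u) = \<kappa>" using curv_eq[OF end_t, of "cos u"] cs_t assms by simp
  have "u + m * pi = rate \<kappa> * T / 2" by (simp add: u_def a_def)
  then show "T / 2 = R / c * ((u + m * pi) / sin u)" using su r R c by simp
  show "turn \<kappa> T = arccos (c * cos u) + m * pi"
    using turn_add_half_periods(1)[OF assms(1) t0, of m] T turn_eq_arccos[of \<kappa> t] snt tpos assms
      sqrt_one_plus_end[OF end_t] cs_t by (simp add: mult.commute)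
qed

text \<open>Converse of \<open>arc_end_simple\<close>. By
  \<open>1 - \<kappa>^2 = (c / R)^2 (X^2 - 1)\<close> the position of \<open>X\<close> relative to 1
  decides the type of the arc.\<close>

lemma arc_exists:
  assumes X: "-1 < X" "X < 1 / c"
  shows "(sn (curv X) (2 * half_len X))\<^sup>2 = (R / c)\<^sup>2"
    and "1 < curv X \<Longrightarrow> rate (curv X) * (2 * half_len X) / 2 < pi"
    and "turn (curv X) (2 * half_len X) = arccos (c * X)"
    and "\<And>t. 0 < t \<Longrightarrow> t \<le> 2 * half_len X \<Longrightarrow> 0 < sn (curv X) t"
proof -
  define \<kappa> T where "\<kappa> = curv X" and "T = 2 * half_len X"
  have kp: "0 < \<kappa>" "0 < T" using curv_pos[OF X] half_len_pos[OF X(1)] by (auto simp: \<kappa>_def T_def)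
  have k2: "1 - \<kappa>\<^sup>2 = (c / R)\<^sup>2 * (X\<^sup>2 - 1)"
  proof -
    have "\<kappa>\<^sup>2 = (1 - c\<^sup>2 * X\<^sup>2) / R\<^sup>2" using curv_sq[OF X] R by (simp add: \<kappa>_def field_simps)
    then have "1 - \<kappa>\<^sup>2 = (R\<^sup>2 - 1 + c\<^sup>2 * X\<^sup>2) / R\<^sup>2" using R by (simp add: field_simps)
    also have "R\<^sup>2 - 1 + c\<^sup>2 * X\<^sup>2 = c\<^sup>2 * (X\<^sup>2 - 1)" using Rc by (simp add: algebra_simps)
    finally show ?thesis by (simp add: power_divide)
  qed
  have rate: "rate \<kappa> = c / R * sqrt \<bar>X\<^sup>2 - 1\<bar>"
    unfolding rate_def k2 using c R by (simp add: abs_mult real_sqrt_mult)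
  consider "X < 1" | "X = 1" | "X > 1" by linarith
  then have "sn \<kappa> T = R / c \<and> cs \<kappa> T = X \<and> (1 < \<kappa> \<longrightarrow> rate \<kappa> * T / 2 < pi)
    \<and> (\<forall>t. 0 < t \<longrightarrow> t \<le> T \<longrightarrow> 0 < sn \<kappa> t)"
  proof cases
    case 1
    define u where "u = arccos X"
    have u: "0 < u" "u < pi" "cos u = X"
      using X 1 arccos_lt_bounded[of X] by (auto simp: u_def)
    have su: "0 < sin u" using u sin_gt_zero by simp
    have X1: "X\<^sup>2 < 1" using X 1 by (simp add: abs_square_less_1)
    then have "(c / R)\<^sup>2 * (X\<^sup>2 - 1) < 0" using R c by (intro mult_pos_neg) auto
    then have kk: "1 < \<kappa>\<^sup>2" using k2 by linarith
    then have k1: "1 < \<kappa>" using kp power_le_one[of \<kappa> 2] by force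
    have "sqrt \<bar>X\<^sup>2 - 1\<bar> = sin u"
      using X1 su by (simp add: u(3)[symmetric] sin_squared_eq[symmetric] abs_minus_commute)
    then have r: "rate \<kappa> = c / R * sin u" using rate by simp
    have ru: "rate \<kappa> * T / 2 = u"
      using inv_sinc_cos[OF u(1,2)] su R c by (simp add: r T_def half_len_def u(3))
    have "0 < sn \<kappa> t" if "0 < t" "t \<le> T" for t
    proof (rule sn_pos[OF k1 that(1)])
      have "rate \<kappa> * t \<le> rate \<kappa> * T" using that r su R c by (intro mult_left_mono) auto
      then show "rate \<kappa> * t / 2 < pi" using ru u by linarith
    qed
    moreover have "sn \<kappa> T = R / c" "cs \<kappa> T = X"
      using kk su R c u(3) unfolding sn_def cs_def ru by (auto simp: r)
    ultimately show ?thesis using ru u by auto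
  next
    case 2
    then have "\<kappa>\<^sup>2 = 1" using k2 by simp
    then have "\<kappa> = 1" using kp by (simp add: power2_eq_1_iff)
    then show ?thesis using 2 by (auto simp: sn_def cs_def T_def half_len_def inv_sinc_def)
  next
    case 3
    define h where "h = arcosh X"
    have h: "0 < h" "cosh h = X"
      using 3 by (auto simp: h_def)
    have sh: "0 < sinh h" using h by simp
    have X1: "1 < X\<^sup>2" using 3 by simp
    then have "(c / R)\<^sup>2 * (X\<^sup>2 - 1) > 0" using R c by simp
    then have kk: "\<kappa>\<^sup>2 < 1" using k2 by linarith
    then have k1: "\<kappa> < 1" using one_le_power[of \<kappa> 2] by linarith
    have "sqrt \<bar>X\<^sup>2 - 1\<bar> = sinh h"
      using X1 sh by (simp add: h(2)[symmetric] sinh_square_eq[symmetric])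
    then have r: "rate \<kappa> = c / R * sinh h" using rate by simp
    have ru: "rate \<kappa> * T / 2 = h"
      using inv_sinc_cosh[OF h(1)] sh R c by (simp add: r T_def half_len_def h(2))
    have "0 < sn \<kappa> t" if "0 < t" for t
      using that kk r sh R c by (simp add: sn_def)
    moreover have "sn \<kappa> T = R / c" "cs \<kappa> T = X"
      using kk sh R c h(2) unfolding sn_def cs_def ru by (auto simp: r)
    ultimately show ?thesis using k1 by auto
  qed
  then have *: "sn \<kappa> T = R / c" "cs \<kappa> T = X" "1 < \<kappa> \<longrightarrow> rate \<kappa> * T / 2 < pi"
    "\<And>t. 0 < t \<Longrightarrow> t \<le> T \<Longrightarrow> 0 < sn \<kappa> t" by auto
  then show "(sn (curv X) (2 * half_len X))\<^sup>2 = (R / c)\<^sup>2"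
    and "1 < curv X \<Longrightarrow> rate (curv X) * (2 * half_len X) / 2 < pi"
    and "\<And>t. 0 < t \<Longrightarrow> t \<le> 2 * half_len X \<Longrightarrow> 0 < sn (curv X) t"
    by (auto simp: \<kappa>_def T_def)
  show "turn (curv X) (2 * half_len X) = arccos (c * X)"
    using turn_eq_arccos[of \<kappa> T] sqrt_one_plus_end[of \<kappa> T] * kp
    by (simp add: \<kappa>_def T_def mult.commute)
qed

end

subsection \<open>The geodesic equation in coordinates\<close>

definition coN :: "real ^ 3 \<Rightarrow> real" where
  "coN p = 1 - (p $ 2)\<^sup>2 - (p $ 3)\<^sup>2"

lemma cmod_base_sq: "(cmod (base p))\<^sup>2 = (p $ 2)\<^sup>2 + (p $ 3)\<^sup>2"
  by (simp add: base_def cmod_def)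

lemma RD_iff: "p \<in> RD \<longleftrightarrow> 0 < coN p"
proof -
  have "p \<in> RD \<longleftrightarrow> (cmod (base p))\<^sup>2 < 1" by (simp add: RD_def abs_square_less_1)
  then show ?thesis unfolding cmod_base_sq coN_def by linarith
qed

definition eta_co :: "3 \<Rightarrow> real ^ 3 \<Rightarrow> real" where
  "eta_co i p = (if i = 1 then 1 else if i = 2 then - 2 * p $ 3 / coN p else 2 * p $ 2 / coN p)"

lemma eta_eq: "eta p u = u $ 1 + eta_co 2 p * u $ 2 + eta_co 3 p * u $ 3"
  by (simp add: eta_def eta_co_def coN_def diff_divide_distrib algebra_simps)

lemma eta_axis: "eta p (axis i 1) = eta_co i p"
  using exhaust_3[of i] by (auto simp: eta_eq eta_co_def axis_def)

lemma sasaki_metric_entry: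
  "sasaki_metric M p $ i $ j = (if i = j \<and> i \<noteq> 1 then 4 / (coN p)\<^sup>2 else 0) + eta_co i p * eta_co j p / M"
proof -
  have "base (axis i 1) \<bullet> base (axis j 1) = (if i = j \<and> i \<noteq> 1 then 1 else 0)"
    using exhaust_3[of i] exhaust_3[of j] by (auto simp: base_def axis_def inner_complex_def)
  moreover have "1 - (cmod (base p))\<^sup>2 = coN p" by (simp add: cmod_base_sq coN_def)
  ultimately show ?thesis
    by (cases "i = j \<and> i \<noteq> 1") (auto simp: sasaki_metric_def sasaki_form_def eta_axis)
qed

lemma coN_deriv:
  "((\<lambda>s. coN (p + s *\<^sub>R axis k 1)) has_real_derivative (if k = 1 then 0 else - 2 * p $ k)) (at 0)"
  using exhaust_3[of k] unfolding coN_def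
  by (auto simp: axis_def intro!: derivative_eq_intros)

definition dcoN :: "3 \<Rightarrow> real ^ 3 \<Rightarrow> real" where
  "dcoN k p = (if k = 1 then 0 else - 2 * p $ k)"

definition deta :: "3 \<Rightarrow> 3 \<Rightarrow> real ^ 3 \<Rightarrow> real" where
  "deta k i p = (if i = 1 then 0
     else if i = 2 then - 2 * ((if k = 3 then 1 else 0) * coN p - p $ 3 * dcoN k p) / (coN p)\<^sup>2
     else 2 * ((if k = 2 then 1 else 0) * coN p - p $ 2 * dcoN k p) / (coN p)\<^sup>2)"

lemma eta_co_deriv:
  assumes "0 < coN p"
  shows "((\<lambda>s. eta_co i (p + s *\<^sub>R axis k 1)) has_real_derivative deta k i p) (at 0)"
proof -
  have N: "((\<lambda>s. coN (p + s *\<^sub>R axis k 1)) has_real_derivative dcoN k p) (at 0)"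
    using coN_deriv[of p k] by (simp add: dcoN_def)
  have x: "((\<lambda>s. (p + s *\<^sub>R axis k 1) $ j) has_real_derivative (if k = j then 1 else 0)) (at 0)" for j
    by (auto simp: axis_def intro!: derivative_eq_intros)
  have q: "((\<lambda>s. a * (p + s *\<^sub>R axis k 1) $ j / coN (p + s *\<^sub>R axis k 1)) has_real_derivative
      (a * (if k = j then 1 else 0) * coN p - a * p $ j * dcoN k p) / (coN p)\<^sup>2) (at 0)" for a j
    using DERIV_divide[OF DERIV_cmult[OF x, of a j] N] assms by (simp add: power2_eq_square)
  show ?thesis
  proof -
    consider "i = 1" | "i = 2" | "i = 3" using exhaust_3[of i] by blast
    then show ?thesis
    proof cases
      case 1 then show ?thesis by (simp add: eta_co_def deta_def)
    next
      case 2 then show ?thesis using q[of "-2" 3] by (simp add: eta_co_def deta_def algebra_simps)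
    next
      case 3 then show ?thesis using q[of 2 2] by (simp add: eta_co_def deta_def algebra_simps)
    qed
  qed
qed

lemma coord_deriv_sasaki_metric:
  assumes "0 < coN p"
  shows "coord_deriv k (\<lambda>q. sasaki_metric M q $ i $ j) p =
    (if i = j \<and> i \<noteq> 1 then - 8 * dcoN k p / (coN p)^3 else 0)
    + (deta k i p * eta_co j p + eta_co i p * deta k j p) / M"
proof -
  have N: "((\<lambda>s. coN (p + s *\<^sub>R axis k 1)) has_real_derivative dcoN k p) (at 0)"
    using coN_deriv[of p k] by (simp add: dcoN_def)
  have L: "((\<lambda>s. 4 / (coN (p + s *\<^sub>R axis k 1))\<^sup>2) has_real_derivative - 8 * dcoN k p / (coN p)^3) (at 0)"
    using assms by (auto intro!: derivative_eq_intros N simp: power2_eq_square power3_eq_cube)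
  have E: "((\<lambda>s. eta_co i (p + s *\<^sub>R axis k 1) * eta_co j (p + s *\<^sub>R axis k 1) / M) has_real_derivative
      (deta k i p * eta_co j p + eta_co i p * deta k j p) / M) (at 0)"
    using DERIV_cdivide[OF DERIV_mult[OF eta_co_deriv[OF assms, of i k] eta_co_deriv[OF assms, of j k]], of M]
    by (simp add: mult.commute)
  have "((\<lambda>s. sasaki_metric M (p + s *\<^sub>R axis k 1) $ i $ j) has_real_derivative
     (if i = j \<and> i \<noteq> 1 then - 8 * dcoN k p / (coN p)^3 else 0)
    + (deta k i p * eta_co j p + eta_co i p * deta k j p) / M) (at 0)"
    unfolding sasaki_metric_entry
    by (intro DERIV_add E) (use L in \<open>auto\<close>)
  then show ?thesis unfolding coord_deriv_def by (rule DERIV_imp_deriv)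
qed

text \<open>Christoffel symbols of the first kind contracted with the velocity. With the index
  lowered, the inverse metric need not be computed: invertibility is enough.\<close>

definition christoffel_low :: "real \<Rightarrow> real ^ 3 \<Rightarrow> real ^ 3 \<Rightarrow> real ^ 3" where
  "christoffel_low M p u = (\<chi> l. \<Sum>i\<in>UNIV. \<Sum>j\<in>UNIV. 1/2 *
       (coord_deriv i (\<lambda>q. sasaki_metric M q $ j $ l) p
        + coord_deriv j (\<lambda>q. sasaki_metric M q $ i $ l) p
        - coord_deriv l (\<lambda>q. sasaki_metric M q $ i $ j) p) * u $ i * u $ j)"

lemma christoffel_sum:
  "(\<Sum>i\<in>UNIV. \<Sum>j\<in>UNIV. christoffel (sasaki_metric M) k i j p * u $ i * u $ j)
    = (matrix_inv (sasaki_metric M p) *v christoffel_low M p u) $ k"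
proof -
  have "(\<Sum>i\<in>UNIV. \<Sum>j\<in>UNIV. 1/2 * (\<Sum>l\<in>UNIV. A l * C i j l) * u $ i * u $ j)
      = (\<Sum>l\<in>UNIV. A l * (\<Sum>i\<in>UNIV. \<Sum>j\<in>UNIV. 1/2 * C i j l * u $ i * u $ j))"
    for A :: "3 \<Rightarrow> real" and C :: "3 \<Rightarrow> 3 \<Rightarrow> 3 \<Rightarrow> real"
    unfolding sum_3 by (simp add: algebra_simps)
  then show ?thesis
    unfolding christoffel_def christoffel_low_def matrix_vector_mult_def by simp
qed

lemma invertible_sasaki_metric:
  assumes "0 < M" "0 < coN p"
  shows "invertible (sasaki_metric M p)"
proof -
  define L A B m where "L = 4 / (coN p)\<^sup>2" and "A = eta_co 2 p" and "B = eta_co 3 p" and "m = inverse M"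
  have g: "sasaki_metric M p $ i $ j = (if i = j \<and> i \<noteq> 1 then L else 0) + eta_co i p * eta_co j p * m" for i j
    unfolding sasaki_metric_entry L_def m_def by (auto simp: divide_inverse)
  have one: "eta_co 1 p = 1" by (simp add: eta_co_def)
  have "det (sasaki_metric M p) = L\<^sup>2 * m"
    by (simp add: det_3 g one power2_eq_square algebra_simps flip: A_def B_def)
  then have "det (sasaki_metric M p) \<noteq> 0" using assms by (simp add: L_def m_def)
  then show ?thesis by (simp add: invertible_det_nz)
qed

lemma geodesic_equation_low:
  assumes "0 < M" "0 < coN p"
  shows "(\<forall>k. a $ k + (\<Sum>i\<in>UNIV. \<Sum>j\<in>UNIV. christoffel (sasaki_metric M) k i j p * u $ i * u $ j) = 0)
    \<longleftrightarrow> sasaki_metric M p *v a + christoffel_low M p u = 0"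
proof -
  let ?G = "sasaki_metric M p"
  have "?G ** matrix_inv ?G = mat 1 \<and> matrix_inv ?G ** ?G = mat 1"
    using invertible_sasaki_metric[OF assms] unfolding invertible_def matrix_inv_def by (rule someI_ex)
  then have inv: "?G ** matrix_inv ?G = mat 1" "matrix_inv ?G ** ?G = mat 1" by auto
  have "(\<forall>k. a $ k + (\<Sum>i\<in>UNIV. \<Sum>j\<in>UNIV. christoffel (sasaki_metric M) k i j p * u $ i * u $ j) = 0)
    \<longleftrightarrow> a + matrix_inv ?G *v christoffel_low M p u = 0"
    by (simp add: christoffel_sum vec_eq_iff)
  also have "\<dots> \<longleftrightarrow> ?G *v a + christoffel_low M p u = 0"
  proof
    assume "a + matrix_inv ?G *v christoffel_low M p u = 0"
    then have "?G *v (a + matrix_inv ?G *v christoffel_low M p u) = 0" by simp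
    then show "?G *v a + christoffel_low M p u = 0"
      by (simp add: matrix_vector_right_distrib matrix_vector_mul_assoc inv)
  next
    assume "?G *v a + christoffel_low M p u = 0"
    then have "matrix_inv ?G *v (?G *v a + christoffel_low M p u) = 0" by simp
    then show "a + matrix_inv ?G *v christoffel_low M p u = 0"
      by (simp add: matrix_vector_right_distrib matrix_vector_mul_assoc inv)
  qed
  finally show ?thesis .
qed

text \<open>The derivative of \<eta>(\<sigma>') for position \<open>p\<close>, velocity
  \<open>u\<close> and acceleration \<open>a\<close>; see \<open>eta_deriv\<close>.\<close>

definition eta_dot :: "real ^ 3 \<Rightarrow> real ^ 3 \<Rightarrow> real ^ 3 \<Rightarrow> real" where
  "eta_dot p u a = eta p a + (\<Sum>k\<in>UNIV. (deta k 2 p * u $ 2 + deta k 3 p * u $ 3) * u $ k)"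

text \<open>For \<open>(i, j, s) = (2, 3, 1)\<close> and \<open>(3, 2, -1)\<close> the vanishing of this expression is the magnetic
  geodesic equation of the base curve, with charge \<open>\<eta>(\<sigma>') / M\<close>.\<close>

definition base_defect :: "3 \<Rightarrow> 3 \<Rightarrow> real \<Rightarrow> real \<Rightarrow> real ^ 3 \<Rightarrow> real ^ 3 \<Rightarrow> real ^ 3 \<Rightarrow> real" where
  "base_defect i j s M p u a = a $ i + 4 * (p $ 2 * u $ 2 + p $ 3 * u $ 3) * u $ i / coN p
     - 2 * p $ i * ((u $ 2)\<^sup>2 + (u $ 3)\<^sup>2) / coN p - s * eta p u / M * u $ j"

text \<open>The exterior derivative of \<eta> is the area form of the Poincare metric. In the
  geodesic equation it becomes the magnetic force on the base curve.\<close>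

lemma deta_curl: "deta 2 3 p - deta 3 2 p = 4 / (coN p)\<^sup>2" if "0 < coN p"
  using that unfolding deta_def dcoN_def
  by (simp add: field_simps) (simp add: coN_def power2_eq_square algebra_simps)

lemma christoffel_low_entry:
  assumes "0 < coN p"
  shows "christoffel_low M p u $ l =
    (\<Sum>i\<in>UNIV. \<Sum>j\<in>UNIV. 1/2 *
      (((if j = l \<and> j \<noteq> 1 then - 8 * dcoN i p / (coN p)^3 else 0)
         + (deta i j p * eta_co l p + eta_co j p * deta i l p) * inverse M)
       + ((if i = l \<and> i \<noteq> 1 then - 8 * dcoN j p / (coN p)^3 else 0)
         + (deta j i p * eta_co l p + eta_co i p * deta j l p) * inverse M)
       - ((if i = j \<and> i \<noteq> 1 then - 8 * dcoN l p / (coN p)^3 else 0)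
         + (deta l i p * eta_co j p + eta_co i p * deta l j p) * inverse M)) * u $ i * u $ j)"
  unfolding christoffel_low_def coord_deriv_sasaki_metric[OF assms] vec_lambda_beta divide_inverse[of _ M]
  by (rule refl)

text \<open>The rows are triangular: the first is conservation of the fibre momentum, the others are
  multiples of it plus a base equation. So all three vanish exactly when \<open>eta_dot\<close> and
  both defects do.\<close>

lemma geodesic_low_entries:
  fixes E :: "real ^ 3"
  assumes "0 < M" "0 < coN p"
    and E_def: "E = sasaki_metric M p *v a + christoffel_low M p u"
  shows "E $ 1 = eta_dot p u a / M"
    and "E $ 2 = eta_co 2 p * eta_dot p u a / M + 4 / (coN p)\<^sup>2 * base_defect 2 3 1 M p u a"
    and "E $ 3 = eta_co 3 p * eta_dot p u a / M + 4 / (coN p)\<^sup>2 * base_defect 3 2 (-1) M p u a"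
proof -
  define m L Q A B A2 A3 B2 B3 where "m = inverse M" and "L = 4 / (coN p)\<^sup>2" and "Q = 16 / (coN p)^3"
    and "A = eta_co 2 p" and "B = eta_co 3 p"
    and "A2 = deta 2 2 p" and "A3 = deta 3 2 p" and "B2 = deta 2 3 p" and "B3 = deta 3 3 p"
  have z: "deta 1 i p = 0" "deta i 1 p = 0" "dcoN 1 p = 0" "eta_co 1 p = 1" for i
    by (auto simp: deta_def dcoN_def eta_co_def)
  have d: "- 8 * dcoN 2 p / (coN p)^3 = Q * p $ 2" "- 8 * dcoN 3 p / (coN p)^3 = Q * p $ 3"
    "- 8 * dcoN 1 p / (coN p)^3 = 0"
    by (simp_all add: dcoN_def Q_def)
  have curl: "B2 = A3 + L" using deta_curl[OF assms(2)] by (simp add: A3_def B2_def L_def)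
  note abbr = m_def[symmetric] L_def[symmetric] A_def[symmetric] B_def[symmetric] A2_def[symmetric]
    A3_def[symmetric] B2_def[symmetric] B3_def[symmetric]
  have LN: "L * (x / coN p) = Q / 4 * x" for x
    using assms(2) by (simp add: L_def Q_def power2_eq_square power3_eq_cube)
  have g: "sasaki_metric M p $ i $ j = (if i = j \<and> i \<noteq> 1 then L else 0) + eta_co i p * eta_co j p * m" for i j
    unfolding sasaki_metric_entry L_def m_def by (auto simp: divide_inverse)
  have eta: "eta p u = u $ 1 + A * u $ 2 + B * u $ 3" for u by (simp add: eta_eq A_def B_def)
  have dot: "eta_dot p u a = a $ 1 + A * a $ 2 + B * a $ 3 + (A2 * u $ 2 + B2 * u $ 3) * u $ 2
      + (A3 * u $ 2 + B3 * u $ 3) * u $ 3"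
    by (simp add: eta_dot_def eta sum_3 z abbr)
  have low: "christoffel_low M p u $ l =
    (\<Sum>i\<in>UNIV. \<Sum>j\<in>UNIV. 1/2 *
      (((if j = l \<and> j \<noteq> 1 then - 8 * dcoN i p / (coN p)^3 else 0)
         + (deta i j p * eta_co l p + eta_co j p * deta i l p) * m)
       + ((if i = l \<and> i \<noteq> 1 then - 8 * dcoN j p / (coN p)^3 else 0)
         + (deta j i p * eta_co l p + eta_co i p * deta j l p) * m)
       - ((if i = j \<and> i \<noteq> 1 then - 8 * dcoN l p / (coN p)^3 else 0)
         + (deta l i p * eta_co j p + eta_co i p * deta l j p) * m)) * u $ i * u $ j)" for l
    unfolding m_def by (rule christoffel_low_entry[OF assms(2)])
  have Ga: "(sasaki_metric M p *v a) $ l = (\<Sum>j\<in>UNIV. ((if l = j \<and> l \<noteq> 1 then L else 0)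
      + eta_co l p * eta_co j p * m) * a $ j)" for l
    by (simp add: matrix_vector_mult_def g)
  have bd: "L * base_defect i j s M p u a = L * a $ i + Q * (p $ 2 * u $ 2 + p $ 3 * u $ 3) * u $ i
     - Q / 2 * p $ i * ((u $ 2)\<^sup>2 + (u $ 3)\<^sup>2) - L * s * (u $ 1 + A * u $ 2 + B * u $ 3) * m * u $ j" for i j s
  proof -
    have "L * base_defect i j s M p u a = L * a $ i
      + L * ((4 * (p $ 2 * u $ 2 + p $ 3 * u $ 3) * u $ i) / coN p)
      - L * ((2 * p $ i * ((u $ 2)\<^sup>2 + (u $ 3)\<^sup>2)) / coN p) - L * s * (u $ 1 + A * u $ 2 + B * u $ 3) * m * u $ j"
      unfolding base_defect_def eta m_def by (simp add: divide_inverse algebra_simps)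
    then show ?thesis unfolding LN by (simp add: algebra_simps)
  qed
  define X where "X = (A2 * u $ 2 + B2 * u $ 3) * u $ 2 + (A3 * u $ 2 + B3 * u $ 3) * u $ 3"
  \<comment> \<open>The first two families of terms differ by exchanging \<open>i\<close> and
    \<open>j\<close> and contribute equally to the symmetric sum; this halves the expansion.\<close>
  have half: "(\<Sum>i\<in>UNIV. \<Sum>j\<in>UNIV. 1/2 * (f i j + f j i - h i j) * u $ i * u $ j)
      = (\<Sum>i\<in>UNIV. \<Sum>j\<in>UNIV. f i j * u $ i * u $ j) - 1/2 * (\<Sum>i\<in>UNIV. \<Sum>j\<in>UNIV. h i j * u $ i * u $ j)"
    for f h :: "3 \<Rightarrow> 3 \<Rightarrow> real"
    unfolding sum_3 by (simp add: algebra_simps)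
  note low' = low[unfolded half[of "\<lambda>i j. (if j = _ \<and> j \<noteq> 1 then - 8 * dcoN i p / (coN p)^3 else 0)
         + (deta i j p * eta_co _ p + eta_co j p * deta i _ p) * m"]]
  have low1: "christoffel_low M p u $ 1 = m * X"
    unfolding low' sum_3 z d abbr X_def by (simp add: algebra_simps)
  have low2: "christoffel_low M p u $ 2 = Q * (p $ 2 * u $ 2 + p $ 3 * u $ 3) * u $ 2
     - Q / 2 * p $ 2 * ((u $ 2)\<^sup>2 + (u $ 3)\<^sup>2) + m * (A * X - (u $ 1 + A * u $ 2 + B * u $ 3) * L * u $ 3)"
    unfolding low' sum_3 z d abbr X_def curl by (simp add: power2_eq_square algebra_simps)
  have low3: "christoffel_low M p u $ 3 = Q * (p $ 2 * u $ 2 + p $ 3 * u $ 3) * u $ 3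
     - Q / 2 * p $ 3 * ((u $ 2)\<^sup>2 + (u $ 3)\<^sup>2) + m * (B * X + (u $ 1 + A * u $ 2 + B * u $ 3) * L * u $ 2)"
    unfolding low' sum_3 z d abbr X_def curl by (simp add: power2_eq_square algebra_simps)
  have dot': "eta_dot p u a = a $ 1 + A * a $ 2 + B * a $ 3 + X"
    unfolding dot X_def by simp
  show "E $ 1 = eta_dot p u a / M"
    unfolding E_def vector_add_component low1 Ga sum_3 z dot' abbr divide_inverse
    by (simp add: algebra_simps)
  have "E $ 2 = eta_co 2 p * eta_dot p u a * m + L * base_defect 2 3 1 M p u a"
    unfolding E_def vector_add_component low2 Ga sum_3 z dot' abbr bd
    by (simp add: algebra_simps)
  then show "E $ 2 = eta_co 2 p * eta_dot p u a / M + 4 / (coN p)\<^sup>2 * base_defect 2 3 1 M p u a"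
    by (simp add: m_def L_def divide_inverse)
  have "E $ 3 = eta_co 3 p * eta_dot p u a * m + L * base_defect 3 2 (-1) M p u a"
    unfolding E_def vector_add_component low3 Ga sum_3 z dot' abbr bd
    by (simp add: algebra_simps)
  then show "E $ 3 = eta_co 3 p * eta_dot p u a / M + 4 / (coN p)\<^sup>2 * base_defect 3 2 (-1) M p u a"
    by (simp add: m_def L_def divide_inverse)
qed

lemma sasaki_geodesic_equation:
  assumes "0 < M" "p \<in> RD"
  shows "(\<forall>k. a $ k + (\<Sum>i\<in>UNIV. \<Sum>j\<in>UNIV. christoffel (sasaki_metric M) k i j p * u $ i * u $ j) = 0)
    \<longleftrightarrow> eta_dot p u a = 0 \<and> base_defect 2 3 1 M p u a = 0 \<and> base_defect 3 2 (-1) M p u a = 0"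
proof -
  have N: "0 < coN p" using assms(2) RD_iff by simp
  have "(\<forall>k. a $ k + (\<Sum>i\<in>UNIV. \<Sum>j\<in>UNIV. christoffel (sasaki_metric M) k i j p * u $ i * u $ j) = 0)
    \<longleftrightarrow> (\<forall>k. (sasaki_metric M p *v a + christoffel_low M p u) $ k = 0)"
    unfolding geodesic_equation_low[OF assms(1) N] by (simp add: vec_eq_iff)
  also have "\<dots> \<longleftrightarrow> eta_dot p u a = 0 \<and> base_defect 2 3 1 M p u a = 0 \<and> base_defect 3 2 (-1) M p u a = 0"
    unfolding forall_3 geodesic_low_entries[OF assms(1) N refl] using assms(1) N by auto
  finally show ?thesis .
qed

text \<open>The term with \<open>cnj\<close> is the Levi-Civita part of the conformal metric on the
  disc; the other is the magnetic force, a quarter turn of the velocity.\<close>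

lemma base_equation_complex:
  "base_defect 2 3 1 M p u a = 0 \<and> base_defect 3 2 (-1) M p u a = 0 \<longleftrightarrow>
   base a = - (\<i> * of_real (eta p u / M) * base u) - 2 * cnj (base p) * (base u)\<^sup>2 / of_real (coN p)"
proof -
  define h n where "h = eta p u / M" and "n = inverse (coN p)"
  have x: "base_defect 2 3 1 M p u a = Re (base a + \<i> * of_real h * base u + 2 * cnj (base p) * (base u)\<^sup>2 * of_real n)"
    by (simp add: base_defect_def base_def divide_inverse power2_eq_square flip: n_def)
      (simp add: h_def divide_inverse algebra_simps)
  have y: "base_defect 3 2 (-1) M p u a = Im (base a + \<i> * of_real h * base u + 2 * cnj (base p) * (base u)\<^sup>2 * of_real n)"
    by (simp add: base_defect_def base_def divide_inverse power2_eq_square flip: n_def)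
      (simp add: h_def divide_inverse algebra_simps)
  have "base_defect 2 3 1 M p u a = 0 \<and> base_defect 3 2 (-1) M p u a = 0 \<longleftrightarrow>
     base a + \<i> * of_real h * base u + 2 * cnj (base p) * (base u)\<^sup>2 * of_real n = 0"
    unfolding x y complex_eq_iff by simp
  also have "\<dots> \<longleftrightarrow> base a = - (\<i> * of_real h * base u) - 2 * cnj (base p) * (base u)\<^sup>2 * of_real n"
    by (rule iffI) algebra+
  finally show ?thesis by (simp add: h_def n_def divide_inverse)
qed

lemma eta_deriv:
  assumes \<sigma>: "(\<sigma> has_vector_derivative \<sigma>' t) (at t within S)"
    and \<sigma>': "(\<sigma>' has_vector_derivative a) (at t within S)" and N: "0 < coN (\<sigma> t)"
  shows "((\<lambda>t. eta (\<sigma> t) (\<sigma>' t)) has_real_derivative eta_dot (\<sigma> t) (\<sigma>' t) a) (at t within S)"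
proof -
  have c: "((\<lambda>t. \<sigma> t $ i) has_real_derivative \<sigma>' t $ i) (at t within S)"
    "((\<lambda>t. \<sigma>' t $ i) has_real_derivative a $ i) (at t within S)" for i
    using bounded_linear.has_vector_derivative[OF bounded_linear_vec_nth \<sigma>]
      bounded_linear.has_vector_derivative[OF bounded_linear_vec_nth \<sigma>']
    by (simp_all add: has_real_derivative_iff_has_vector_derivative)
  have n: "((\<lambda>t. coN (\<sigma> t)) has_real_derivative - 2 * \<sigma> t $ 2 * \<sigma>' t $ 2 - 2 * \<sigma> t $ 3 * \<sigma>' t $ 3) (at t within S)"
    unfolding coN_def by (auto intro!: derivative_eq_intros c)
  have q: "((\<lambda>t. b * \<sigma> t $ i / coN (\<sigma> t)) has_real_derivative
      b * (\<sigma>' t $ i * coN (\<sigma> t) + \<sigma> t $ i * (2 * \<sigma> t $ 2 * \<sigma>' t $ 2 + 2 * \<sigma> t $ 3 * \<sigma>' t $ 3)) / (coN (\<sigma> t))\<^sup>2)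
      (at t within S)" for b i
    using DERIV_divide[OF DERIV_cmult[OF c(1), of b i] n] N by (simp add: power2_eq_square algebra_simps)
  have "((\<lambda>t. \<sigma>' t $ 1 + (- 2) * \<sigma> t $ 3 / coN (\<sigma> t) * \<sigma>' t $ 2 + 2 * \<sigma> t $ 2 / coN (\<sigma> t) * \<sigma>' t $ 3)
      has_real_derivative eta_dot (\<sigma> t) (\<sigma>' t) a) (at t within S)"
  proof (rule DERIV_cong[OF DERIV_add[OF DERIV_add[OF c(2) DERIV_mult[OF q c(2)]] DERIV_mult[OF q c(2)]]])
    define n where "n = inverse (coN (\<sigma> t))"
    have "coN (\<sigma> t) * n = 1" using N by (simp add: n_def)
    then show "a $ 1 + ((- 2) * (\<sigma>' t $ 3 * coN (\<sigma> t) + \<sigma> t $ 3 * (2 * \<sigma> t $ 2 * \<sigma>' t $ 2 + 2 * \<sigma> t $ 3 * \<sigma>' t $ 3)) / (coN (\<sigma> t))\<^sup>2 * \<sigma>' t $ 2 +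
         a $ 2 * ((- 2) * \<sigma> t $ 3 / coN (\<sigma> t))) +
        (2 * (\<sigma>' t $ 2 * coN (\<sigma> t) + \<sigma> t $ 2 * (2 * \<sigma> t $ 2 * \<sigma>' t $ 2 + 2 * \<sigma> t $ 3 * \<sigma>' t $ 3)) / (coN (\<sigma> t))\<^sup>2 * \<sigma>' t $ 3 +
         a $ 3 * (2 * \<sigma> t $ 2 / coN (\<sigma> t))) = eta_dot (\<sigma> t) (\<sigma>' t) a"
      by (simp add: eta_dot_def eta_eq eta_co_def deta_def dcoN_def sum_3 divide_inverse
          power_inverse flip: n_def) (simp add: algebra_simps)
  qed
  then show ?thesis by (simp add: eta_eq eta_co_def)
qed

lemma sasaki_energy:
  "u \<bullet> (sasaki_metric M p *v u) = 4 * (cmod (base u))\<^sup>2 / (coN p)\<^sup>2 + (eta p u)\<^sup>2 / M"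
proof -
  define L A B where "L = 4 / (coN p)\<^sup>2" and "A = eta_co 2 p" and "B = eta_co 3 p"
  have g: "sasaki_metric M p $ i $ j = (if i = j \<and> i \<noteq> 1 then L else 0) + eta_co i p * eta_co j p * inverse M" for i j
    unfolding sasaki_metric_entry L_def by (auto simp: divide_inverse)
  have "eta_co 1 p = 1" by (simp add: eta_co_def)
  then have "u \<bullet> (sasaki_metric M p *v u) = L * (cmod (base u))\<^sup>2 + (eta p u)\<^sup>2 * inverse M"
    by (simp add: inner_vec_def matrix_vector_mult_def sum_3 g eta_eq cmod_base_sq flip: A_def B_def)
      (simp add: algebra_simps power2_eq_square)
  then show ?thesis by (simp add: L_def divide_inverse)
qed

subsection \<open>Base curves as arcs of dipole circles\<close>

text \<open>Gronwall argument: the squared norm times \<open>exp (- 2 * K * s)\<close> is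
  nonincreasing and starts at 0.\<close>

lemma linear_growth_zero:
  fixes f :: "real \<Rightarrow> 'a::real_inner"
  assumes f: "\<And>t. t \<in> {0..T} \<Longrightarrow> (f has_vector_derivative f' t) (at t within {0..T})"
    and bound: "\<And>t. t \<in> {0..T} \<Longrightarrow> norm (f' t) \<le> K * norm (f t)"
    and "f 0 = 0" "t \<in> {0..T}"
  shows "f t = 0"
proof -
  define g where "g s = exp (- 2 * K * s) * (f s \<bullet> f s)" for s
  define g' where "g' s = exp (- 2 * K * s) * (2 * (f s \<bullet> f' s) - 2 * K * (f s \<bullet> f s))" for s
  have g: "(g has_real_derivative g' s) (at s within {0..t})" if "s \<in> {0..t}" for s
  proof -
    have "(f has_vector_derivative f' s) (at s within {0..t})"
      by (rule has_vector_derivative_within_subset[OF f]) (use that assms(4) in auto)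
    from bounded_bilinear.has_vector_derivative[OF bounded_bilinear_inner this this]
    have "((\<lambda>s. f s \<bullet> f s) has_real_derivative f s \<bullet> f' s + f' s \<bullet> f s) (at s within {0..t})"
      by (simp add: has_real_derivative_iff_has_vector_derivative)
    then show ?thesis unfolding g_def g'_def
      by (auto intro!: derivative_eq_intros simp: inner_commute algebra_simps)
  qed
  have g': "g' s \<le> 0" if "s \<in> {0..t}" for s
  proof -
    have "f s \<bullet> f' s \<le> norm (f s) * norm (f' s)" by (rule norm_cauchy_schwarz)
    also have "\<dots> \<le> norm (f s) * (K * norm (f s))" using bound[of s] that assms(4) by (intro mult_left_mono) auto
    also have "\<dots> = K * (f s \<bullet> f s)" by (simp add: dot_square_norm power2_eq_square)
    finally show ?thesis by (simp add: g'_def mult_nonneg_nonpos)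
  qed
  have "\<exists>x\<in>{0..t}. g t - g 0 = g' x * (t - 0)"
    using assms(4) g by (intro mvt_very_simple) (auto simp: has_field_derivative_def)
  then have "g t \<le> g 0" using g' assms(4) by (smt (verit) atLeastAtMost_iff mult_nonpos_nonneg)
  then have "f t \<bullet> f t \<le> 0" using assms(3) by (simp add: g_def mult_le_0_iff)
  then show ?thesis by (metis inner_eq_zero_iff inner_ge_zero order_antisym)
qed

lemma velocity_eq:
  assumes "0 < T" "t \<in> {0..T}" "(f has_vector_derivative f') (at t within {0..T})"
  shows "velocity T f t = f'"
  unfolding velocity_def using vector_derivative_within_cbox[of 0 T t f f'] assms by simp

lemma bounded_linear_base: "bounded_linear base"
  unfolding linear_conv_bounded_linear[symmetric]
  by (rule linearI) (auto simp: base_def complex_eq_iff)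

lemma base_deriv:
  "(\<sigma> has_vector_derivative u) F \<Longrightarrow> ((\<lambda>t. base (\<sigma> t)) has_vector_derivative base u) F"
  by (rule bounded_linear.has_vector_derivative[OF bounded_linear_base])

lemma sasaki_geodesic_iff:
  assumes "0 < M"
  shows "sasaki_geodesic M T \<sigma> \<longleftrightarrow> 0 < T \<and> (\<exists>\<sigma>' \<sigma>''. \<forall>t\<in>{0..T}. 0 < coN (\<sigma> t) \<and>
    (\<sigma> has_vector_derivative \<sigma>' t) (at t within {0..T}) \<and>
    (\<sigma>' has_vector_derivative \<sigma>'' t) (at t within {0..T}) \<and>
    eta_dot (\<sigma> t) (\<sigma>' t) (\<sigma>'' t) = 0 \<and>
    base (\<sigma>'' t) = - (\<i> * of_real (eta (\<sigma> t) (\<sigma>' t) / M) * base (\<sigma>' t))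
      - 2 * cnj (base (\<sigma> t)) * (base (\<sigma>' t))\<^sup>2 / of_real (coN (\<sigma> t)))"
  unfolding sasaki_geodesic_def geodesic_on_def base_equation_complex[symmetric] RD_iff[symmetric]
  by (auto simp: sasaki_geodesic_equation[OF assms] cong: conj_cong)

lemma coN_base: "coN p = 1 - (cmod (base p))\<^sup>2"
  by (simp add: coN_def cmod_base_sq)

lemma coN_complex: "complex_of_real (coN p) = 1 - base p * cnj (base p)"
  by (simp add: coN_base of_real_power[symmetric] complex_norm_square del: of_real_power)

lemma eta_base: "eta p u = u $ 1 + 2 * Im (cnj (base p) * base u) / coN p"
  by (simp add: eta_def coN_def base_def)

section \<open>Explicit arcs and the proof that they are Sasaki geodesics\<close>

definition arc_den :: "real \<Rightarrow> real \<Rightarrow> complex" where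
  "arc_den \<kappa> s = Complex (cs \<kappa> s) (\<kappa> * sn \<kappa> s)"

definition arc_base :: "real \<Rightarrow> real \<Rightarrow> complex" where
  "arc_base \<kappa> s = of_real (sn \<kappa> s) / arc_den \<kappa> s"

lemma cmod_arc_den: "(cmod (arc_den \<kappa> s))\<^sup>2 = 1 + (sn \<kappa> s)\<^sup>2"
  by (simp add: arc_den_def cmod_def cs_sq power_mult_distrib algebra_simps)

lemma arc_den_neq_0 [simp]: "arc_den \<kappa> s \<noteq> 0"
  using cmod_arc_den[of \<kappa> s] one_plus_sq_neq_0[of "sn \<kappa> s"] by auto

lemma cmod_arc_base: "(cmod (arc_base \<kappa> s))\<^sup>2 = (sn \<kappa> s)\<^sup>2 / (1 + (sn \<kappa> s)\<^sup>2)"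
  by (simp add: arc_base_def norm_divide power_divide cmod_arc_den)

lemma arc_base_0 [simp]: "arc_base \<kappa> 0 = 0"
  by (simp add: arc_base_def)

lemma arc_den_eq: "arc_den \<kappa> s = of_real (cs \<kappa> s) + \<i> * of_real \<kappa> * of_real (sn \<kappa> s)"
  by (simp add: arc_den_def complex_eq_iff)

lemma sn_complex_deriv:
  "((\<lambda>s. complex_of_real (sn \<kappa> s)) has_vector_derivative of_real (cs \<kappa> s / 2)) (at s within A)"
  "((\<lambda>s. complex_of_real (cs \<kappa> s)) has_vector_derivative of_real ((1 - \<kappa>\<^sup>2) * sn \<kappa> s / 2)) (at s within A)"
  by (intro has_vector_derivative_of_real sn_deriv cs_deriv)+

lemma arc_den_deriv:
  "(arc_den \<kappa> has_vector_derivative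
     of_real ((1 - \<kappa>\<^sup>2) * sn \<kappa> s / 2) + \<i> * of_real \<kappa> * of_real (cs \<kappa> s / 2)) (at s within A)"
  unfolding arc_den_eq[abs_def]
  by (intro has_vector_derivative_add has_vector_derivative_mult_right sn_complex_deriv)

text \<open>The dipole circle \<open>Im w = - \<kappa> |w|^2\<close> as a polynomial identity in
  \<open>w\<close> and \<open>cnj w\<close>.\<close>

lemma arc_dipole: "cnj (arc_base \<kappa> s) - arc_base \<kappa> s = 2 * \<i> * of_real \<kappa> * arc_base \<kappa> s * cnj (arc_base \<kappa> s)"
proof -
  have "arc_den \<kappa> s - cnj (arc_den \<kappa> s) = 2 * \<i> * of_real \<kappa> * of_real (sn \<kappa> s)"
    by (simp add: arc_den_def complex_eq_iff)
  then have "S / cnj (arc_den \<kappa> s) - S / arc_den \<kappa> s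
      = S * (2 * \<i> * of_real \<kappa> * of_real (sn \<kappa> s)) / (arc_den \<kappa> s * cnj (arc_den \<kappa> s))" for S
    by (simp add: diff_frac_eq flip: right_diff_distrib')
  then show ?thesis
    by (simp add: arc_base_def mult.commute mult.left_commute)
qed

text \<open>A Riccati equation whose right side is a Killing field of the disc: the arc is an orbit
  of a one-parameter group of Moebius isometries.\<close>

lemma arc_base_deriv:
  "(arc_base \<kappa> has_vector_derivative (1 - 2 * \<i> * of_real \<kappa> * arc_base \<kappa> s - (arc_base \<kappa> s)\<^sup>2) / 2) (at s within A)"
proof -
  define z S C k where "z = arc_den \<kappa> s" and "S = complex_of_real (sn \<kappa> s)" and "C = complex_of_real (cs \<kappa> s)"
    and "k = complex_of_real \<kappa>"
  have z: "z \<noteq> 0" "z = C + \<i> * k * S" unfolding z_def S_def C_def k_def by (rule arc_den_neq_0, rule arc_den_eq)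
  have quot: "a * (- (inverse z ^ Suc (Suc 0))) = - (a / z\<^sup>2)" for a
    by (simp add: power2_eq_square divide_inverse)
  have "((inverse \<circ> arc_den \<kappa>) has_vector_derivative
      ((1 - k\<^sup>2) * S / 2 + \<i> * k * C / 2) * (- (inverse z ^ Suc (Suc 0)))) (at s within A)"
    unfolding z_def
    by (rule field_vector_diff_chain_within[OF _ DERIV_inverse])
      (use arc_den_deriv[of \<kappa> s A] in \<open>simp_all add: S_def C_def k_def\<close>)
  then have inv: "((\<lambda>s. inverse (arc_den \<kappa> s)) has_vector_derivative
      - (((1 - k\<^sup>2) * S / 2 + \<i> * k * C / 2) / z\<^sup>2)) (at s within A)"
    unfolding o_def quot .
  have "(arc_base \<kappa> has_vector_derivative
      S * - (((1 - k\<^sup>2) * S / 2 + \<i> * k * C / 2) / z\<^sup>2) + C / 2 * inverse z) (at s within A)"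
    unfolding arc_base_def[abs_def] divide_inverse[of "of_real _" "arc_den _ _"]
    using has_vector_derivative_mult[OF sn_complex_deriv(1) inv] by (simp add: S_def C_def z_def)
  moreover have "S * - (((1 - k\<^sup>2) * S / 2 + \<i> * k * C / 2) / z\<^sup>2) + C / 2 * inverse z
      = (1 - 2 * \<i> * k * (S / z) - (S / z)\<^sup>2) / 2"
  proof -
    have num: "C * z - S * ((1 - k\<^sup>2) * S + \<i> * k * C) = z\<^sup>2 - 2 * \<i> * k * S * z - S\<^sup>2"
      unfolding z(2) by (simp add: power2_eq_square algebra_simps)
    have "S * - (a / z\<^sup>2) + C / 2 * inverse z = (C * z - S * (2 * a)) / (2 * z\<^sup>2)" for a
      using z(1) by (simp add: field_simps power2_eq_square)
    then have "S * - (((1 - k\<^sup>2) * S / 2 + \<i> * k * C / 2) / z\<^sup>2) + C / 2 * inverse z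
        = (C * z - S * (2 * ((1 - k\<^sup>2) * S / 2 + \<i> * k * C / 2))) / (2 * z\<^sup>2)" .
    also have "2 * ((1 - k\<^sup>2) * S / 2 + \<i> * k * C / 2) = (1 - k\<^sup>2) * S + \<i> * k * C"
      by simp
    also have "(C * z - S * ((1 - k\<^sup>2) * S + \<i> * k * C)) / (2 * z\<^sup>2)
        = (1 - 2 * \<i> * k * S / z - (S / z)\<^sup>2) / 2"
    proof -
      have "(z\<^sup>2 - e * z - S\<^sup>2) / (2 * z\<^sup>2) = (1 - e / z - (S / z)\<^sup>2) / 2" for e
        using z(1) by (simp add: field_simps power2_eq_square)
      then show ?thesis unfolding num .
    qed
    finally show ?thesis by simp
  qed
  ultimately have "(arc_base \<kappa> has_vector_derivative (1 - 2 * \<i> * k * (S / z) - (S / z)\<^sup>2) / 2) (at s within A)"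
    by (rule subst[rotated])
  then show ?thesis unfolding arc_base_def S_def z_def k_def .
qed

text \<open>On the dipole circle the Moebius field exchanges \<open>cnj w\<close> for
  \<open>w\<close> up to the conformal factor. Speed, connection term and acceleration of the arcs
  are all evaluated through this identity.\<close>

lemma dipole_radial:
  assumes H: "cnj w - w = 2 * \<i> * k * w * cnj w"
    and D: "w' = v / 2 * (1 - 2 * \<i> * k * w - w\<^sup>2)"
  shows "cnj w * w' = v / 2 * w * (1 - w * cnj w)"
proof -
  have "cnj w * w' = v / 2 * (cnj w - 2 * \<i> * k * w * cnj w - w * w * cnj w)"
    unfolding D by (simp add: power2_eq_square algebra_simps)
  also have "\<dots> = v / 2 * w * (1 - w * cnj w)"
    unfolding H[symmetric] by (simp add: algebra_simps)
  finally show ?thesis .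
qed

definition std_arc :: "real \<Rightarrow> real \<Rightarrow> real \<Rightarrow> real ^ 3" where
  "std_arc M \<kappa> s = (\<chi> i. if i = 1 then (M + 1) * \<kappa> * s - 2 * turn \<kappa> s
     else if i = 2 then Re (arc_base \<kappa> s) else Im (arc_base \<kappa> s))"

lemma base_arc [simp]: "base (std_arc M \<kappa> s) = arc_base \<kappa> s"
  by (simp add: std_arc_def base_def)

lemma angle_arc [simp]: "angle (std_arc M \<kappa> s) = (M + 1) * \<kappa> * s - 2 * turn \<kappa> s"
  by (simp add: std_arc_def angle_def)

lemma vec3_eqI: "angle p = angle q \<Longrightarrow> base p = base q \<Longrightarrow> p = q"
  unfolding vec_eq_iff forall_3 by (simp add: angle_def base_def)

lemma has_vector_derivative_vec3:
  assumes "(f has_vector_derivative a) (at s within A)" "(g has_vector_derivative b) (at s within A)"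
  shows "((\<lambda>s. (\<chi> i. if i = 1 then f s else if i = 2 then Re (g s) else Im (g s)) :: real ^ 3)
    has_vector_derivative (\<chi> i. if i = 1 then a else if i = 2 then Re b else Im b)) (at s within A)"
proof -
  define \<Phi> where "\<Phi> = (\<lambda>(a :: real, b). (\<chi> i. if i = 1 then a else if i = 2 then Re b else Im b) :: real ^ 3)"
  have "linear \<Phi>"
    by (auto simp: \<Phi>_def linear_iff vec_eq_iff)
  then have "bounded_linear \<Phi>" by (rule linear_conv_bounded_linear[THEN iffD1])
  from bounded_linear.has_vector_derivative[OF this, of "\<lambda>s. (f s, g s)" "(a, b)" "at s within A"]
  show ?thesis using has_vector_derivative_Pair[OF assms] by (simp add: \<Phi>_def)
qed

lemma dipole_Im:
  assumes "cnj w - w = 2 * \<i> * of_real k * w * cnj w"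
  shows "Im w = - k * (cmod w)\<^sup>2"
proof -
  have "cnj w - w = 2 * \<i> * of_real k * of_real ((cmod w)\<^sup>2)"
    using assms by (simp only: complex_norm_square mult.assoc)
  then have "Im (cnj w - w) = Im (2 * \<i> * of_real k * of_real ((cmod w)\<^sup>2))" by (rule arg_cong)
  then show ?thesis by (simp del: of_real_power)
qed

lemma dipole_connection:
  assumes H: "cnj (base p) - base p = 2 * \<i> * of_real k * base p * cnj (base p)"
    and D: "base u = of_real v / 2 * (1 - 2 * \<i> * of_real k * base p - (base p)\<^sup>2)" and N: "0 < coN p"
  shows "eta p u = u $ 1 - v * k * (cmod (base p))\<^sup>2"
proof -
  have "cnj (base p) * base u = of_real v / 2 * base p * of_real (coN p)"
    unfolding coN_complex by (rule dipole_radial[OF H D])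
  also have "\<dots> = of_real (v / 2 * coN p) * base p" by simp
  finally have "Im (cnj (base p) * base u) = Im (of_real (v / 2 * coN p) * base p)" by (rule arg_cong)
  moreover have "Im (of_real r * z) = r * Im z" for r z by simp
  ultimately have "Im (cnj (base p) * base u) = v / 2 * coN p * Im (base p)" by metis
  then show ?thesis using N dipole_Im[OF H] by (simp add: eta_base)
qed

lemma coN_arc: "coN (std_arc M \<kappa> s) = 1 / (1 + (sn \<kappa> s)\<^sup>2)"
  by (simp add: coN_base cmod_arc_base field_simps)

lemma coN_arc_pos: "0 < coN (std_arc M \<kappa> s)"
  by (simp add: coN_arc one_plus_sq_pos)

definition arc_vel :: "real \<Rightarrow> real \<Rightarrow> real \<Rightarrow> real ^ 3" where
  "arc_vel M \<kappa> s = (let b = (1 - 2 * \<i> * of_real \<kappa> * arc_base \<kappa> s - (arc_base \<kappa> s)\<^sup>2) / 2 in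
     \<chi> i. if i = 1 then (M + 1) * \<kappa> - \<kappa> / (1 + (sn \<kappa> s)\<^sup>2) else if i = 2 then Re b else Im b)"

lemma base_arc_vel: "base (arc_vel M \<kappa> s) = (1 - 2 * \<i> * of_real \<kappa> * arc_base \<kappa> s - (arc_base \<kappa> s)\<^sup>2) / 2"
  by (rule complex_eqI) (simp_all add: arc_vel_def base_def Let_def)

lemma arc_deriv:
  assumes "s \<in> {0..T}"
  shows "(std_arc M \<kappa> has_vector_derivative arc_vel M \<kappa> s) (at s within {0..T})"
proof -
  have "((\<lambda>s. (M + 1) * \<kappa> * s - 2 * turn \<kappa> s) has_vector_derivative
      (M + 1) * \<kappa> - \<kappa> / (1 + (sn \<kappa> s)\<^sup>2)) (at s within {0..T})"
    unfolding has_real_derivative_iff_has_vector_derivative[symmetric]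
    by (rule derivative_eq_intros turn_deriv_within[OF assms] refl)+
      (simp add: divide_simps algebra_simps)
  from has_vector_derivative_vec3[OF this arc_base_deriv[of \<kappa> s]]
  show ?thesis unfolding std_arc_def[abs_def] arc_vel_def Let_def .
qed

lemma eta_arc_vel: "eta (std_arc M \<kappa> s) (arc_vel M \<kappa> s) = M * \<kappa>"
proof -
  have "eta (std_arc M \<kappa> s) (arc_vel M \<kappa> s) = arc_vel M \<kappa> s $ 1 - 1 * \<kappa> * (cmod (base (std_arc M \<kappa> s)))\<^sup>2"
    by (rule dipole_connection[OF _ _ coN_arc_pos]) (use arc_dipole[of \<kappa> s] in \<open>simp_all add: base_arc_vel\<close>)
  also have "\<dots> = M * \<kappa> + \<kappa> - (\<kappa> / (1 + (sn \<kappa> s)\<^sup>2) + \<kappa> * ((sn \<kappa> s)\<^sup>2 / (1 + (sn \<kappa> s)\<^sup>2)))"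
    by (simp add: arc_vel_def Let_def cmod_arc_base algebra_simps)
  also have "\<kappa> / (1 + (sn \<kappa> s)\<^sup>2) + \<kappa> * ((sn \<kappa> s)\<^sup>2 / (1 + (sn \<kappa> s)\<^sup>2)) = \<kappa>"
    using nonzero_mult_div_cancel_right[of "1 + (sn \<kappa> s)\<^sup>2" \<kappa>]
    by (simp add: distrib_left add_divide_distrib)
  finally show ?thesis by simp
qed

lemma arc_sasaki_geodesic:
  assumes "0 < M" "0 < T"
  shows "sasaki_geodesic M T (std_arc M \<kappa>)"
proof -
  define b where "b s = (1 - 2 * \<i> * of_real \<kappa> * arc_base \<kappa> s - (arc_base \<kappa> s)\<^sup>2) / 2" for s
  define b2 where "b2 s = - (\<i> * of_real \<kappa> * b s) - arc_base \<kappa> s * b s" for s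
  define acc :: "real \<Rightarrow> real ^ 3" where "acc s = (\<chi> i. if i = 1 then \<kappa> * sn \<kappa> s * cs \<kappa> s / (1 + (sn \<kappa> s)\<^sup>2)\<^sup>2
     else if i = 2 then Re (b2 s) else Im (b2 s))" for s
  have wd: "(arc_base \<kappa> has_vector_derivative b s) (at s within A)" for s A
    unfolding b_def by (rule arc_base_deriv)
  have "(b has_vector_derivative b2 s) (at s within A)" for s A
    unfolding b_def[abs_def] power2_eq_square
    by (rule derivative_eq_intros wd refl)+ (simp add: b2_def field_simps)
  moreover have "((\<lambda>s. (M + 1) * \<kappa> - \<kappa> / (1 + (sn \<kappa> s)\<^sup>2)) has_vector_derivative
      \<kappa> * sn \<kappa> s * cs \<kappa> s / (1 + (sn \<kappa> s)\<^sup>2)\<^sup>2) (at s within A)" for s A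
    unfolding has_real_derivative_iff_has_vector_derivative[symmetric]
    using one_plus_sq_neq_0[of "sn \<kappa> s"]
    by (auto intro!: derivative_eq_intros simp: power2_eq_square)
  ultimately have acc: "(arc_vel M \<kappa> has_vector_derivative acc s) (at s within A)" for s A
    unfolding arc_vel_def[abs_def] Let_def acc_def b_def[symmetric]
    by (intro has_vector_derivative_vec3)
  \<comment> \<open>Instead of expanding \<open>eta_dot\<close>, it is recognised as the derivative
    of \<eta> of the velocity, which is the constant \<open>M * \<kappa>\<close>.\<close>
  have "eta_dot (std_arc M \<kappa> s) (arc_vel M \<kappa> s) (acc s) = 0" if "s \<in> {0..T}" for s
  proof -
    from eta_deriv[OF arc_deriv[OF that] acc coN_arc_pos]
    have 1: "((\<lambda>s. M * \<kappa>) has_vector_derivative eta_dot (std_arc M \<kappa> s) (arc_vel M \<kappa> s) (acc s)) (at s within {0..T})"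
      by (simp add: eta_arc_vel has_real_derivative_iff_has_vector_derivative)
    have 2: "((\<lambda>s. M * \<kappa>) has_vector_derivative 0) (at s within {0..T})" by simp
    show ?thesis
      by (rule vector_derivative_unique_within_closed_interval[of 0 T s])
        (use assms that 1 2 in auto)
  qed
  moreover have "base (acc s) = - (\<i> * of_real (eta (std_arc M \<kappa> s) (arc_vel M \<kappa> s) / M) * base (arc_vel M \<kappa> s))
      - 2 * cnj (base (std_arc M \<kappa> s)) * (base (arc_vel M \<kappa> s))\<^sup>2 / of_real (coN (std_arc M \<kappa> s))" for s
  proof -
    define w n where "w = arc_base \<kappa> s" and "n = complex_of_real (coN (std_arc M \<kappa> s))"
    have n: "n \<noteq> 0" "n = 1 - w * cnj w"
      using coN_arc_pos[of M \<kappa> s] coN_complex[of "std_arc M \<kappa> s"] by (auto simp: n_def w_def)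
    have "cnj w * b s = 1 / 2 * w * (1 - w * cnj w)"
      by (rule dipole_radial[OF arc_dipole[of \<kappa> s, folded w_def]]) (simp add: b_def w_def)
    \<comment> \<open>The antiholomorphic term becomes \<open>w * b s\<close>, the term that
      differentiating the Riccati field produces.\<close>
    then have "2 * cnj w * (b s)\<^sup>2 / n = w * b s"
      using n(1) unfolding n(2)[symmetric] by (simp add: power2_eq_square field_simps)
    moreover have bv: "base (arc_vel M \<kappa> s) = b s" by (simp add: base_arc_vel b_def)
    moreover have "base (acc s) = b2 s" by (simp add: acc_def base_def)
    ultimately show ?thesis
      using assms(1) by (simp add: eta_arc_vel bv b2_def flip: w_def n_def)
  qed
  ultimately show ?thesis
    unfolding sasaki_geodesic_iff[OF assms(1)]
    using assms(2) coN_arc_pos arc_deriv acc by (intro conjI exI[of _ "arc_vel M \<kappa>"] exI[of _ acc]) auto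
qed

lemma velocity_base:
  assumes "0 < T" "t \<in> {0..T}" "(\<sigma> has_vector_derivative u) (at t within {0..T})"
  shows "velocity T (base \<circ> \<sigma>) t = base u"
  using velocity_eq[OF assms(1,2) base_deriv[OF assms(3)]] by (simp add: o_def)

lemma arc_standard_position:
  assumes "0 < M" "0 < T"
  shows "standard_position M T (std_arc M \<kappa>)"
proof -
  have "velocity T (base \<circ> std_arc M \<kappa>) 0 = base (arc_vel M \<kappa> 0)"
    by (rule velocity_base[OF assms(2) _ arc_deriv]) (use assms in auto)
  also have "\<dots> = complex_of_real (1 / 2)" by (simp add: base_arc_vel)
  finally show ?thesis
    unfolding standard_position_def
    using arc_sasaki_geodesic[OF assms] by (auto intro!: exI[of _ 1])
qed

section \<open>Constant speed and uniqueness of the base curve\<close>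

lemma sasaki_length_constant_speed:
  assumes "0 < T" and der: "\<And>t. t \<in> {0..T} \<Longrightarrow> (\<sigma> has_vector_derivative \<sigma>' t) (at t within {0..T})"
    and speed: "\<And>t. t \<in> {0..T} \<Longrightarrow> 4 * (cmod (base (\<sigma>' t)))\<^sup>2 / (coN (\<sigma> t))\<^sup>2 + (eta (\<sigma> t) (\<sigma>' t))\<^sup>2 / M = E"
  shows "sasaki_length M T \<sigma> = T * sqrt E"
proof -
  have "sasaki_length M T \<sigma> = integral {0..T} (\<lambda>t. sqrt E)"
    unfolding sasaki_length_def riemannian_length_def
  proof (rule integral_cong)
    fix t assume t: "t \<in> {0..T}"
    then have v: "velocity T \<sigma> t = \<sigma>' t" using assms(1) der by (intro velocity_eq)
    show "sqrt (velocity T \<sigma> t \<bullet> (sasaki_metric M (\<sigma> t) *v velocity T \<sigma> t)) = sqrt E"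
      unfolding v sasaki_energy speed[OF t] ..
  qed
  also have "\<dots> = T * sqrt E" using assms(1) by simp
  finally show ?thesis .
qed

lemma derivative_zero_constant:
  assumes "\<And>t. t \<in> {0..T} \<Longrightarrow> (f has_real_derivative 0) (at t within {0..T})" "t \<in> {0..T}"
  shows "f t = f 0"
proof -
  obtain c where "\<And>x. x \<in> {0..T} \<Longrightarrow> f x = c"
    using has_field_derivative_zero_constant[of "{0..T}" f] assms(1) by auto
  then show ?thesis using assms(2) by simp
qed

text \<open>The magnetic term is orthogonal to the velocity and does no work, so it drops out of the
  speed.\<close>

lemma inner_magnetic:
  assumes "w'' = - (\<i> * of_real p * w') - 2 * cnj w * w'\<^sup>2 / of_real N"
  shows "w' \<bullet> w'' = - 2 * (w' \<bullet> w') * (w \<bullet> w') / N"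
  unfolding assms
  by (simp add: inner_complex_def power2_eq_square add_divide_distrib diff_divide_distrib algebra_simps)

lemma base_speed_constant:
  assumes w: "\<And>t. t \<in> {0..T} \<Longrightarrow> (w has_vector_derivative w' t) (at t within {0..T})"
    and w': "\<And>t. t \<in> {0..T} \<Longrightarrow> (w' has_vector_derivative w'' t) (at t within {0..T})"
    and eq: "\<And>t. t \<in> {0..T} \<Longrightarrow> w'' t = - (\<i> * of_real p * w' t) - 2 * cnj (w t) * (w' t)\<^sup>2 / of_real (1 - (cmod (w t))\<^sup>2)"
    and disc: "\<And>t. t \<in> {0..T} \<Longrightarrow> cmod (w t) < 1" and t: "t \<in> {0..T}"
  shows "(cmod (w' t))\<^sup>2 / (1 - (cmod (w t))\<^sup>2)\<^sup>2 = (cmod (w' 0))\<^sup>2 / (1 - (cmod (w 0))\<^sup>2)\<^sup>2"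
proof (rule derivative_zero_constant[OF _ t])
  fix t assume t: "t \<in> {0..T}"
  define N a b where "N = 1 - (cmod (w t))\<^sup>2" and "a = w' t \<bullet> w' t" and "b = w t \<bullet> w' t"
  have N: "0 < N" using disc[OF t] by (simp add: N_def abs_square_less_1)
  have 1: "((\<lambda>t. (cmod (w' t))\<^sup>2) has_real_derivative - 4 * a * b / N) (at t within {0..T})"
  proof -
    from bounded_bilinear.has_vector_derivative[OF bounded_bilinear_inner w'[OF t] w'[OF t]]
    have "((\<lambda>t. (cmod (w' t))\<^sup>2) has_real_derivative 2 * (w' t \<bullet> w'' t)) (at t within {0..T})"
      by (simp add: has_real_derivative_iff_has_vector_derivative power2_norm_eq_inner inner_commute)
    then show ?thesis using inner_magnetic[OF eq[OF t]] by (simp add: N_def a_def b_def mult.assoc)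
  qed
  have 2: "((\<lambda>t. 1 - (cmod (w t))\<^sup>2) has_real_derivative - 2 * b) (at t within {0..T})"
  proof -
    from bounded_bilinear.has_vector_derivative[OF bounded_bilinear_inner w[OF t] w[OF t]]
    have "((\<lambda>t. (cmod (w t))\<^sup>2) has_real_derivative 2 * b) (at t within {0..T})"
      by (simp add: has_real_derivative_iff_has_vector_derivative power2_norm_eq_inner inner_commute b_def)
    from DERIV_diff[OF DERIV_const this] show ?thesis by simp
  qed
  have 3: "((\<lambda>t. (1 - (cmod (w t))\<^sup>2)\<^sup>2) has_real_derivative 2 * N * (- 2 * b)) (at t within {0..T})"
    by (rule DERIV_cong[OF DERIV_power[OF 2, of 2]]) (simp add: N_def)
  have "(1 - (cmod (w t))\<^sup>2)\<^sup>2 \<noteq> 0" using N by (simp add: N_def)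
  from DERIV_divide[OF 1 3 this]
  show "((\<lambda>t. (cmod (w' t))\<^sup>2 / (1 - (cmod (w t))\<^sup>2)\<^sup>2) has_real_derivative 0) (at t within {0..T})"
  proof (rule DERIV_cong)
    have "(cmod (w' t))\<^sup>2 = a" by (simp add: a_def power2_norm_eq_inner)
    then show "(- 4 * a * b / N * (1 - (cmod (w t))\<^sup>2)\<^sup>2 - (cmod (w' t))\<^sup>2 * (2 * N * (- 2 * b))) /
      ((1 - (cmod (w t))\<^sup>2)\<^sup>2 * (1 - (cmod (w t))\<^sup>2)\<^sup>2) = 0"
      unfolding N_def[symmetric] using N by (simp add: power2_eq_square)
  qed
qed

text \<open>Two linear first-order systems replace the nonlinear uniqueness argument: the deviations
  \<open>D\<close> from the Moebius flow and \<open>H\<close> from the dipole circle, and then the deviation \<open>Q\<close> from the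
  explicit parametrization, all vanish at time 0 and satisfy linear growth bounds.\<close>

lemma dipole_deviation_bound:
  fixes w w' w'' :: complex and v k N :: real
  defines "D \<equiv> w' - of_real v / 2 * (1 - 2 * \<i> * of_real k * w - w\<^sup>2)"
    and "H \<equiv> cnj w - w - 2 * \<i> * of_real k * w * cnj w"
    and "D' \<equiv> w'' - of_real v / 2 * (- (2 * \<i> * of_real k * w') - 2 * w * w')"
    and "H' \<equiv> cnj w' - w' - 2 * \<i> * of_real k * (w * cnj w' + w' * cnj w)"
  assumes eq: "w'' = - (\<i> * of_real (k * v) * w') - 2 * cnj w * w'\<^sup>2 / of_real N"
    and N: "0 < N" "of_real N = 1 - w * cnj w" and speed: "cmod w' = v / 2 * N" and w: "cmod w \<le> 1"
    and v: "0 \<le> v"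
  shows "norm (D', H') \<le> (v * (1 + v / 2) + (2 + 4 * \<bar>k\<bar> + v)) * norm (D, H)"
proof -
  define n K V where "n = complex_of_real N" and "K = complex_of_real k" and "V = complex_of_real v"
  have n: "n \<noteq> 0" "n = 1 - w * cnj w" using N by (auto simp: n_def)
  \<comment> \<open>The derivatives become linear in \<open>D\<close> and \<open>H\<close> with
    coefficients depending on the solution. The factor \<open>2 * w' / n\<close> has modulus
    \<open>v\<close> because the Poincare speed is constant.\<close>
  have D': "D' = - (2 * w' / n) * (cnj w * D + V / 2 * H)"
  proof -
    have "cnj w * D + V / 2 * H = cnj w * w' - V / 2 * w * n"
      unfolding D_def H_def n(2) V_def by (simp add: power2_eq_square field_simps)
    then have "- (2 * w' / n) * (cnj w * D + V / 2 * H) = - (2 * w' / n) * (cnj w * w' - V / 2 * w * n)"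
      by simp
    also have "\<dots> = V * w * w' - 2 * cnj w * w'\<^sup>2 / n"
      using n(1) by (simp add: power2_eq_square field_simps)
    finally have "- (2 * w' / n) * (cnj w * D + V / 2 * H) = V * w * w' - 2 * cnj w * w'\<^sup>2 / n" .
    then show ?thesis unfolding D'_def eq n_def V_def by (simp add: algebra_simps)
  qed
  have H': "H' = cnj D - D - 2 * \<i> * K * (cnj w * D + w * cnj D) - V / 2 * (w + cnj w) * H"
    unfolding H'_def H_def D_def K_def V_def by (simp add: power2_eq_square field_simps)
  have "cmod (2 * w' / n) = v" using speed N(1) by (simp add: norm_divide norm_mult n_def divide_eq_eq)
  moreover have "cmod D' = cmod (2 * w' / n) * cmod (cnj w * D + V / 2 * H)"
    unfolding D' mult_minus_left norm_minus_cancel by (rule norm_mult)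
  ultimately have "cmod D' = v * cmod (cnj w * D + V / 2 * H)" by (simp only:)
  also have "\<dots> \<le> v * (cmod D + v / 2 * cmod H)"
  proof (rule mult_left_mono[OF _ v])
    have "cmod (cnj w * D + V / 2 * H) \<le> cmod w * cmod D + v / 2 * cmod H"
      using norm_triangle_ineq[of "cnj w * D" "V / 2 * H"] v by (simp add: norm_mult V_def)
    also have "cmod w * cmod D \<le> 1 * cmod D" using w by (intro mult_right_mono) auto
    finally show "cmod (cnj w * D + V / 2 * H) \<le> cmod D + v / 2 * cmod H" by simp
  qed
  also have "\<dots> \<le> v * (norm (D, H) + v / 2 * norm (D, H))"
    using v norm_fst_le[of D H] norm_snd_le[of H D] by (intro mult_left_mono add_mono) auto
  finally have 1: "cmod D' \<le> v * (1 + v / 2) * norm (D, H)" by (simp add: algebra_simps)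
  have "cmod H' \<le> cmod (cnj D - D) + cmod (2 * \<i> * K * (cnj w * D + w * cnj D)) + cmod (V / 2 * (w + cnj w) * H)"
  proof -
    have "cmod (A - Y - Z) \<le> cmod A + cmod Y + cmod Z" for A Y Z
      using norm_triangle_ineq4[of "A - Y" Z] norm_triangle_ineq4[of A Y] by linarith
    then show ?thesis unfolding H' .
  qed
  also have "cmod (cnj D - D) \<le> 2 * cmod D"
    using norm_triangle_ineq4[of "cnj D" D] by simp
  also have "cmod (2 * \<i> * K * (cnj w * D + w * cnj D)) \<le> 4 * \<bar>k\<bar> * cmod D"
  proof -
    have "cmod (cnj w * D + w * cnj D) \<le> cmod w * cmod D + cmod w * cmod D"
      using norm_triangle_ineq[of "cnj w * D" "w * cnj D"] by (simp add: norm_mult)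
    also have "\<dots> \<le> 1 * cmod D + 1 * cmod D" using w by (intro add_mono mult_right_mono) auto
    finally have "2 * \<bar>k\<bar> * cmod (cnj w * D + w * cnj D) \<le> 2 * \<bar>k\<bar> * (2 * cmod D)"
      by (intro mult_left_mono) auto
    then show ?thesis by (simp add: norm_mult K_def)
  qed
  also have "cmod (V / 2 * (w + cnj w) * H) \<le> v * cmod H"
  proof -
    have "cmod (w + cnj w) \<le> 2" using norm_triangle_ineq[of w "cnj w"] w by simp
    then have "v / 2 * cmod (w + cnj w) * cmod H \<le> v / 2 * 2 * cmod H"
      using v by (intro mult_right_mono mult_left_mono) auto
    then show ?thesis using v by (simp add: norm_mult V_def)
  qed
  finally have "cmod H' \<le> 2 * cmod D + 4 * \<bar>k\<bar> * cmod D + v * cmod H" by simp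
  also have "\<dots> \<le> 2 * norm (D, H) + 4 * \<bar>k\<bar> * norm (D, H) + v * norm (D, H)"
    using v norm_fst_le[of D H] norm_snd_le[of H D] by (intro mult_left_mono add_mono) auto
  finally have 2: "cmod H' \<le> (2 + 4 * \<bar>k\<bar> + v) * norm (D, H)" by (simp add: algebra_simps)
  have "norm (D', H') \<le> cmod D' + cmod H'" by (rule norm_Pair_le)
  then show ?thesis using 1 2 by (simp add: distrib_right)
qed

lemma magnetic_geodesic_dipole:
  fixes w w' w'' :: "real \<Rightarrow> complex"
  assumes w: "\<And>t. t \<in> {0..T} \<Longrightarrow> (w has_vector_derivative w' t) (at t within {0..T})"
    and w': "\<And>t. t \<in> {0..T} \<Longrightarrow> (w' has_vector_derivative w'' t) (at t within {0..T})"
    and eq: "\<And>t. t \<in> {0..T} \<Longrightarrow> w'' t = - (\<i> * of_real (k * v) * w' t) - 2 * cnj (w t) * (w' t)\<^sup>2 / of_real (1 - (cmod (w t))\<^sup>2)"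
    and disc: "\<And>t. t \<in> {0..T} \<Longrightarrow> cmod (w t) < 1"
    and init: "w 0 = 0" "w' 0 = of_real (v / 2)" "0 < v" and t: "t \<in> {0..T}"
  shows "w' t = of_real v / 2 * (1 - 2 * \<i> * of_real k * w t - (w t)\<^sup>2)"
    and "w t = arc_base k (v * t)"
proof -
  define D where "D t = w' t - of_real v / 2 * (1 - 2 * \<i> * of_real k * w t - (w t)\<^sup>2)" for t
  define H where "H t = cnj (w t) - w t - 2 * \<i> * of_real k * w t * cnj (w t)" for t
  define D' where "D' t = w'' t - of_real v / 2 * (- (2 * \<i> * of_real k * w' t) - 2 * w t * w' t)" for t
  define H' where "H' t = cnj (w' t) - w' t - 2 * \<i> * of_real k * (w t * cnj (w' t) + w' t * cnj (w t))" for t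
  have speed: "cmod (w' t) = v / 2 * (1 - (cmod (w t))\<^sup>2)" if t: "t \<in> {0..T}" for t
  proof -
    have N: "0 < 1 - (cmod (w t))\<^sup>2" using disc[OF t] by (simp add: abs_square_less_1)
    have "(cmod (w' t))\<^sup>2 / (1 - (cmod (w t))\<^sup>2)\<^sup>2 = (v / 2)\<^sup>2"
      using base_speed_constant[OF w w' eq disc t] init by simp
    then have "(cmod (w' t))\<^sup>2 = (v / 2 * (1 - (cmod (w t))\<^sup>2))\<^sup>2"
      using N by (simp add: power_mult_distrib power_divide divide_eq_eq)
    then show ?thesis using N init(3) by (subst (asm) power2_eq_iff_nonneg) auto
  qed
  have DH: "(D s, H s) = 0" if s: "s \<in> {0..T}" for s
  proof (rule linear_growth_zero[where f = "\<lambda>t. (D t, H t)", OF _ _ _ s])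
    fix t assume t: "t \<in> {0..T}"
    have wc: "((\<lambda>t. cnj (w t)) has_vector_derivative cnj (w' t)) (at t within {0..T})"
      by (rule bounded_linear.has_vector_derivative[OF bounded_linear_cnj w[OF t]])
    have "(D has_vector_derivative D' t) (at t within {0..T})"
      unfolding D_def[abs_def] D'_def power2_eq_square
      by (rule derivative_eq_intros w[OF t] w'[OF t] refl)+ (simp add: algebra_simps)
    moreover have "(H has_vector_derivative H' t) (at t within {0..T})"
      unfolding H_def[abs_def] H'_def mult.assoc
      by (rule derivative_eq_intros w[OF t] wc refl)+ (simp add: algebra_simps)
    ultimately show "((\<lambda>t. (D t, H t)) has_vector_derivative (D' t, H' t)) (at t within {0..T})"
      by (rule has_vector_derivative_Pair)
    show "norm (D' t, H' t) \<le> (v * (1 + v / 2) + (2 + 4 * \<bar>k\<bar> + v)) * norm (D t, H t)"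
      unfolding D_def D'_def H_def H'_def
    proof (rule dipole_deviation_bound[OF eq[OF t]])
      show "0 < 1 - (cmod (w t))\<^sup>2" using disc[OF t] by (simp add: abs_square_less_1)
      show "complex_of_real (1 - (cmod (w t))\<^sup>2) = 1 - w t * cnj (w t)"
        by (simp only: of_real_diff of_real_1 complex_norm_square)
    qed (use speed[OF t] disc[OF t] init(3) in auto)
  next
    show "(D 0, H 0) = 0" using init by (simp add: D_def H_def zero_prod_def)
  qed
  have W: "w' t = of_real v / 2 * (1 - 2 * \<i> * of_real k * w t - (w t)\<^sup>2)" if "t \<in> {0..T}" for t
    using DH[OF that] by (simp add: D_def zero_prod_def)
  then show "w' t = of_real v / 2 * (1 - 2 * \<i> * of_real k * w t - (w t)\<^sup>2)" using t by blast
  \<comment> \<open>Clearing the denominator makes the deviation from the Riccati solution linear: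
    \<open>Q' = v / 2 * (- w - i k) * Q\<close>.\<close>
  define Q where "Q t = w t * arc_den k (v * t) - of_real (sn k (v * t))" for t
  have "Q t = 0"
  proof (rule linear_growth_zero[where f = Q, OF _ _ _ t])
    fix t assume t: "t \<in> {0..T}"
    have vt: "((\<lambda>t. v * t) has_vector_derivative v) (at t within {0..T})"
      unfolding has_real_derivative_iff_has_vector_derivative[symmetric] by (auto intro!: derivative_eq_intros)
    note ch = vector_diff_chain_within[OF vt, unfolded o_def]
    define S C K where "S = complex_of_real (sn k (v * t))" and "C = complex_of_real (cs k (v * t))"
      and "K = complex_of_real k"
    have "(Q has_vector_derivative w t * (v *\<^sub>R ((1 - K\<^sup>2) * S / 2 + \<i> * K * C / 2))
        + w' t * arc_den k (v * t) - v *\<^sub>R (C / 2)) (at t within {0..T})"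
      unfolding Q_def[abs_def]
      by (intro has_vector_derivative_diff has_vector_derivative_mult w[OF t])
        (use ch[OF arc_den_deriv] ch[OF sn_complex_deriv(1)] in \<open>simp_all add: S_def C_def K_def\<close>)
    moreover have eqn: "w t * (v *\<^sub>R ((1 - K\<^sup>2) * S / 2 + \<i> * K * C / 2))
        + w' t * arc_den k (v * t) - v *\<^sub>R (C / 2) = of_real v / 2 * (- w t - \<i> * K) * Q t"
      unfolding W[OF t] Q_def arc_den_eq S_def[symmetric] C_def[symmetric] K_def[symmetric]
      by (simp add: scaleR_conv_of_real power2_eq_square field_simps)
    ultimately show "(Q has_vector_derivative of_real v / 2 * (- w t - \<i> * of_real k) * Q t) (at t within {0..T})"
      unfolding eqn unfolding K_def by blast
    have "cmod (- w t - \<i> * K) \<le> 1 + \<bar>k\<bar>"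
      using norm_triangle_ineq4[of "- w t" "\<i> * K"] disc[OF t] by (simp add: norm_mult K_def)
    then have "v / 2 * cmod (- w t - \<i> * K) * cmod (Q t) \<le> v / 2 * (1 + \<bar>k\<bar>) * cmod (Q t)"
      using init(3) by (intro mult_right_mono mult_left_mono) auto
    then show "cmod (of_real v / 2 * (- w t - \<i> * of_real k) * Q t) \<le> v / 2 * (1 + \<bar>k\<bar>) * cmod (Q t)"
      using init(3) by (simp add: norm_mult K_def)
  qed (use init in \<open>simp_all add: Q_def\<close>)
  then show "w t = arc_base k (v * t)" by (simp add: Q_def arc_base_def field_simps)
qed

subsection \<open>Classification of standard geodesics\<close>

text \<open>The initial base speed \<open>v\<close> and the conserved momentum \<eta>(\<sigma>')
  determine everything, with \<kappa> the momentum over \<open>M * v\<close>. The base curve is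
  forced by its magnetic equation, and the angle follows from the momentum since on the dipole
  circle the connection term depends on |w| only.\<close>

lemma standard_position_imp_arc:
  assumes M: "0 < M" and sp: "standard_position M T \<sigma>"
  obtains v \<kappa> where "0 < v" "0 < T" "\<And>t. t \<in> {0..T} \<Longrightarrow> \<sigma> t = std_arc M \<kappa> (v * t)"
    "sasaki_length M T \<sigma> = T * (v * sqrt (1 + M * \<kappa>\<^sup>2))"
proof -
  from sp obtain v where v: "0 < v" "velocity T (base \<circ> \<sigma>) 0 = complex_of_real (v / 2)"
    and geo: "sasaki_geodesic M T \<sigma>" and start: "angle (\<sigma> 0) = 0" "base (\<sigma> 0) = 0"
    unfolding standard_position_def by blast
  from geo obtain \<sigma>' \<sigma>'' where T: "0 < T" and
    N: "\<And>t. t \<in> {0..T} \<Longrightarrow> 0 < coN (\<sigma> t)" and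
    d1: "\<And>t. t \<in> {0..T} \<Longrightarrow> (\<sigma> has_vector_derivative \<sigma>' t) (at t within {0..T})" and
    d2: "\<And>t. t \<in> {0..T} \<Longrightarrow> (\<sigma>' has_vector_derivative \<sigma>'' t) (at t within {0..T})" and
    eta0: "\<And>t. t \<in> {0..T} \<Longrightarrow> eta_dot (\<sigma> t) (\<sigma>' t) (\<sigma>'' t) = 0" and
    eq: "\<And>t. t \<in> {0..T} \<Longrightarrow> base (\<sigma>'' t) = - (\<i> * of_real (eta (\<sigma> t) (\<sigma>' t) / M) * base (\<sigma>' t))
      - 2 * cnj (base (\<sigma> t)) * (base (\<sigma>' t))\<^sup>2 / of_real (coN (\<sigma> t))"
    unfolding sasaki_geodesic_iff[OF M] by blast
  have T0: "0 \<in> {0..T}" using T by simp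
  define h where "h = eta (\<sigma> 0) (\<sigma>' 0)"
  define \<kappa> where "\<kappa> = h / (M * v)"
  have hk: "h / M = \<kappa> * v" "h = M * \<kappa> * v" using M v by (auto simp: \<kappa>_def)
  have eta_h: "eta (\<sigma> t) (\<sigma>' t) = h" if "t \<in> {0..T}" for t
    unfolding h_def
  proof (rule derivative_zero_constant[OF _ that])
    fix t assume t: "t \<in> {0..T}"
    show "((\<lambda>t. eta (\<sigma> t) (\<sigma>' t)) has_real_derivative 0) (at t within {0..T})"
      using eta_deriv[where \<sigma> = \<sigma> and \<sigma>' = \<sigma>', OF d1[OF t] d2[OF t] N[OF t]] eta0[OF t] by simp
  qed
  have w0': "base (\<sigma>' 0) = of_real (v / 2)"
    using velocity_base[OF T T0 d1[OF T0]] v(2) by simp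
  have w: "((\<lambda>t. base (\<sigma> t)) has_vector_derivative base (\<sigma>' t)) (at t within {0..T})"
    "((\<lambda>t. base (\<sigma>' t)) has_vector_derivative base (\<sigma>'' t)) (at t within {0..T})" if "t \<in> {0..T}" for t
    using base_deriv[OF d1[OF that]] base_deriv[OF d2[OF that]] by auto
  have disc: "cmod (base (\<sigma> t)) < 1" if "t \<in> {0..T}" for t
    using N[OF that] by (simp add: coN_base abs_square_less_1)
  have eq': "base (\<sigma>'' t) = - (\<i> * of_real (\<kappa> * v) * base (\<sigma>' t))
      - 2 * cnj (base (\<sigma> t)) * (base (\<sigma>' t))\<^sup>2 / of_real (1 - (cmod (base (\<sigma> t)))\<^sup>2)" if "t \<in> {0..T}" for t
    using eq[OF that] unfolding eta_h[OF that] hk(1) coN_base .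
  have dip: "base (\<sigma>' t) = of_real v / 2 * (1 - 2 * \<i> * of_real \<kappa> * base (\<sigma> t) - (base (\<sigma> t))\<^sup>2)"
    "base (\<sigma> t) = arc_base \<kappa> (v * t)" if "t \<in> {0..T}" for t
    by (rule magnetic_geodesic_dipole[where w = "\<lambda>t. base (\<sigma> t)" and w' = "\<lambda>t. base (\<sigma>' t)"
      and w'' = "\<lambda>t. base (\<sigma>'' t)", OF _ _ _ _ start(2) w0' v(1) that];
      erule w(1) w(2) eq' disc)+
  have speed: "(cmod (base (\<sigma>' t)))\<^sup>2 / (coN (\<sigma> t))\<^sup>2 = (v / 2)\<^sup>2" if "t \<in> {0..T}" for t
  proof -
    have "(cmod (base (\<sigma>' t)))\<^sup>2 / (1 - (cmod (base (\<sigma> t)))\<^sup>2)\<^sup>2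
        = (cmod (base (\<sigma>' 0)))\<^sup>2 / (1 - (cmod (base (\<sigma> 0)))\<^sup>2)\<^sup>2"
      by (rule base_speed_constant[where w = "\<lambda>t. base (\<sigma> t)" and w' = "\<lambda>t. base (\<sigma>' t)"
        and w'' = "\<lambda>t. base (\<sigma>'' t)", OF _ _ _ _ that]; erule w(1) w(2) eq' disc)
    then show ?thesis using v(1) by (simp add: coN_base start w0')
  qed
  have "angle (\<sigma> t) - angle (std_arc M \<kappa> (v * t)) = angle (\<sigma> 0) - angle (std_arc M \<kappa> (v * 0))" if "t \<in> {0..T}" for t
  proof (rule derivative_zero_constant[OF _ that])
    fix t assume t: "t \<in> {0..T}"
    define S where "S = sn \<kappa> (v * t)"
    have wt: "base (\<sigma> t) = arc_base \<kappa> (v * t)" by (rule dip(2)[OF t])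
    have "h = \<sigma>' t $ 1 - v * \<kappa> * (cmod (base (\<sigma> t)))\<^sup>2"
      unfolding eta_h[OF t, symmetric]
      by (rule dipole_connection[OF _ dip(1)[OF t] N[OF t]]) (simp only: wt arc_dipole)
    moreover have "(cmod (base (\<sigma> t)))\<^sup>2 = 1 - 1 / (1 + S\<^sup>2)"
      unfolding wt cmod_arc_base S_def by (simp add: field_simps)
    ultimately have u: "\<sigma>' t $ 1 = (M + 1) * \<kappa> * v - v * \<kappa> / (1 + S\<^sup>2)"
      by (simp add: hk(2) algebra_simps)
    have a: "((\<lambda>t. angle (\<sigma> t)) has_real_derivative \<sigma>' t $ 1) (at t within {0..T})"
      using bounded_linear.has_vector_derivative[OF bounded_linear_vec_nth d1[OF t]]
      by (simp add: angle_def has_real_derivative_iff_has_vector_derivative)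
    have "v * t \<in> {0..v * T}" using t v by (auto intro: mult_left_mono)
    from turn_deriv_within[OF this]
    \<comment> \<open>As an integral from 0, \<open>turn\<close> has a one-sided derivative at 0, so
      the chain rule is applied within the image interval.\<close>
    have tv: "(turn \<kappa> has_real_derivative \<kappa> / (2 * (1 + S\<^sup>2))) (at (v * t) within (\<lambda>t. v * t) ` {0..T})"
      unfolding S_def by (rule has_field_derivative_subset) (use v in \<open>auto intro: mult_left_mono\<close>)
    have "((\<lambda>t. turn \<kappa> (v * t)) has_real_derivative \<kappa> / (2 * (1 + S\<^sup>2)) * v) (at t within {0..T})"
      by (rule DERIV_image_chain[OF tv, unfolded o_def]) (auto intro!: derivative_eq_intros)
    from DERIV_diff[OF a DERIV_diff[OF DERIV_cmult[OF DERIV_ident, of "(M + 1) * \<kappa> * v"] DERIV_cmult[OF this, of 2]]]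
    show "((\<lambda>t. angle (\<sigma> t) - angle (std_arc M \<kappa> (v * t))) has_real_derivative 0) (at t within {0..T})"
      by (simp add: u mult.assoc) (simp add: field_simps)
  qed
  then have ang: "angle (\<sigma> t) = angle (std_arc M \<kappa> (v * t))" if "t \<in> {0..T}" for t
    using that start(1) by fastforce
  have "\<sigma> t = std_arc M \<kappa> (v * t)" if "t \<in> {0..T}" for t
    using dip(2)[OF that] ang[OF that] by (intro vec3_eqI) simp_all
  moreover have "sasaki_length M T \<sigma> = T * (v * sqrt (1 + M * \<kappa>\<^sup>2))"
  proof -
    have "4 * (cmod (base (\<sigma>' t)))\<^sup>2 / (coN (\<sigma> t))\<^sup>2 + (eta (\<sigma> t) (\<sigma>' t))\<^sup>2 / M = v\<^sup>2 * (1 + M * \<kappa>\<^sup>2)"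
      if "t \<in> {0..T}" for t
    proof -
      have "4 * (cmod (base (\<sigma>' t)))\<^sup>2 / (coN (\<sigma> t))\<^sup>2 = v\<^sup>2"
        using speed[OF that] by (simp add: power_divide mult.commute)
      then show ?thesis unfolding eta_h[OF that] hk(2) using M
        by (simp add: power2_eq_square algebra_simps)
    qed
    from sasaki_length_constant_speed[OF T d1 this] show ?thesis
      using v by (simp add: real_sqrt_mult)
  qed
  ultimately show ?thesis using that v T by blast
qed

text \<open>Relative to the centre of the dipole circle the base curve is
  \<open>exp (- 2 i turn \<kappa> s) i / (2 \<kappa>)\<close>.\<close>

lemma arc_winding_number:
  assumes \<kappa>: "0 < \<kappa>" and T: "0 < T" and pos: "\<And>t. 0 < t \<Longrightarrow> t \<le> T \<Longrightarrow> 0 < sn \<kappa> t"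
  shows "winding_number (\<lambda>s. arc_base \<kappa> (s * T)) (dipole_centre \<kappa>) = - of_real (turn \<kappa> T / pi)"
proof -
  \<comment> \<open>A continuous logarithm of the curve seen from the dipole centre. Its constant is
    the logarithm of \<open>i / (2 \<kappa>)\<close>, the position of the starting point 0, and its
    increment over \<open>2 pi i\<close> is the winding number.\<close>
  define p where "p s = Ln (\<i> / (2 * of_real \<kappa>)) + \<i> * of_real (- 2 * turn \<kappa> (s * T))" for s
  have polar: "exp (p s) = arc_base \<kappa> (s * T) - dipole_centre \<kappa>" if s: "0 \<le> s" "s \<le> 1" for s
  proof -
    define t S C q where "t = s * T" and "S = sn \<kappa> t" and "C = cs \<kappa> t" and "q = sqrt (1 + S\<^sup>2)"
    have t: "0 \<le> t" "t \<le> T" using s T by (auto simp: t_def mult_le_cancel_right1)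
    have q: "0 < q" "q\<^sup>2 = 1 + S\<^sup>2" using one_plus_sq_pos[of S] by (auto simp: q_def)
    have S: "0 \<le> S" using pos[of t] t by (cases "t = 0") (auto simp: S_def less_imp_le)
    have turn: "turn \<kappa> t = arccos (C / q)"
      using turn_eq_arccos[OF \<kappa> t(1)] pos t by (simp add: C_def S_def q_def)
    have b: "-1 \<le> C / q" "C / q \<le> 1" using cs_quot_bounds[of \<kappa> t] unfolding C_def S_def q_def by linarith+
    have "cos (turn \<kappa> t) = C / q" using b by (simp add: turn)
    moreover have "sin (turn \<kappa> t) = \<kappa> * S / q"
      using b sin_turn_aux[of \<kappa> t] S \<kappa>
      by (simp add: turn sin_arccos real_sqrt_divide flip: C_def S_def q_def)
    ultimately have den: "arc_den \<kappa> t = of_real q * cis (turn \<kappa> t)"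
      using q(1) by (simp add: arc_den_def complex_eq_iff C_def S_def)
    have "\<i> / (2 * of_real \<kappa>) \<noteq> 0" using \<kappa> by simp
    then have "exp (p s) = \<i> / (2 * of_real \<kappa>) * cis (- turn \<kappa> t - turn \<kappa> t)"
      unfolding p_def exp_add cis_conv_exp t_def by (subst exp_Ln) simp_all
    also have "cis (- turn \<kappa> t - turn \<kappa> t) = cnj (arc_den \<kappa> t) / arc_den \<kappa> t"
      unfolding den complex_cnj_mult complex_cnj_complex_of_real cis_cnj cis_divide[symmetric]
      using q(1) by simp
    also have "\<i> / (2 * of_real \<kappa>) * (cnj (arc_den \<kappa> t) / arc_den \<kappa> t) = arc_base \<kappa> t - dipole_centre \<kappa>"
    proof -
      have c: "dipole_centre \<kappa> = - (\<i> / (2 * of_real \<kappa>))"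
        using \<kappa> by (simp add: dipole_centre_def complex_eq_iff Re_divide Im_divide power2_eq_square)
      have "\<i> * cnj (arc_den \<kappa> t) = 2 * of_real \<kappa> * of_real (sn \<kappa> t) + \<i> * arc_den \<kappa> t"
        by (simp add: arc_den_def complex_eq_iff)
      then show ?thesis unfolding c arc_base_def using \<kappa> by (simp add: field_simps)
    qed
    finally show ?thesis by (simp add: t_def)
  qed
  have "path p"
  proof -
    have "continuous_on {0..1} (\<lambda>s. turn \<kappa> (s * T))"
      by (rule continuous_on_compose2[OF continuous_on_turn[of T]])
        (use T in \<open>auto intro!: continuous_intros simp: mult_le_cancel_right1\<close>)
    then show ?thesis unfolding path_def p_def by (intro continuous_intros)
  qed
  have "winding_number (\<lambda>s. arc_base \<kappa> (s * T)) (dipole_centre \<kappa>)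
      = winding_number (\<lambda>s. arc_base \<kappa> (s * T) - dipole_centre \<kappa>) 0"
    by (rule winding_number_offset)
  also have "\<dots> = winding_number (exp \<circ> p) 0"
    by (rule winding_number_cong) (simp add: polar)
  also have "\<dots> = - of_real (turn \<kappa> T / pi)"
    unfolding winding_number_compose_exp[OF \<open>path p\<close>]
    by (simp add: pathfinish_def pathstart_def p_def field_simps)
  finally show ?thesis .
qed

text \<open>The winding number is \<open>- turn \<kappa> T / pi\<close>, of modulus below 1. This
  holds for every positive \<kappa>, so the elliptic case needs no separate treatment.\<close>

lemma arc_multiplicity_0:
  assumes "0 < M" "0 < \<kappa>" "0 < T" and pos: "\<And>t. 0 < t \<Longrightarrow> t \<le> T \<Longrightarrow> 0 < sn \<kappa> t"
    and turn: "0 \<le> turn \<kappa> T" "turn \<kappa> T < pi"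
  shows "geodesic_multiplicity M T (std_arc M \<kappa>) = 0"
proof -
  have "\<lfloor>\<bar>Re (winding_number (\<lambda>s. base (std_arc M \<kappa> (s * T))) (dipole_centre k))\<bar>\<rfloor> = 0" if "k = \<kappa>" for k
  proof -
    have "winding_number (\<lambda>s. arc_base \<kappa> (s * T)) (dipole_centre \<kappa>) = - of_real (turn \<kappa> T / pi)"
      by (rule arc_winding_number[OF assms(2,3) pos])
    then show ?thesis unfolding that base_arc using turn by (simp add: floor_eq_iff)
  qed
  moreover have "base_curvature M T (std_arc M \<kappa>) = \<kappa>"
  proof -
    have vel: "velocity T (std_arc M \<kappa>) 0 = arc_vel M \<kappa> 0" "velocity T (base \<circ> std_arc M \<kappa>) 0 = base (arc_vel M \<kappa> 0)"
      using velocity_eq[OF assms(3) _ arc_deriv] velocity_base[OF assms(3) _ arc_deriv] assms(3) by auto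
    then show ?thesis
      unfolding base_curvature_def base_speed_def vel using assms(1) by (simp add: eta_arc_vel base_arc_vel)
  qed
  ultimately show ?thesis unfolding geodesic_multiplicity_def Let_def by simp
qed

lemma sasaki_length_std_arc:
  assumes "0 < M" "0 < T"
  shows "sasaki_length M T (std_arc M \<kappa>) = T * sqrt (1 + M * \<kappa>\<^sup>2)"
proof -
  have "4 * (cmod (base (arc_vel M \<kappa> t)))\<^sup>2 / (coN (std_arc M \<kappa> t))\<^sup>2
      + (eta (std_arc M \<kappa> t) (arc_vel M \<kappa> t))\<^sup>2 / M = 1 + M * \<kappa>\<^sup>2" for t
  proof -
    define w b where "w = arc_base \<kappa> t" and "b = base (arc_vel M \<kappa> t)"
    have "cnj w * b = 1 / 2 * w * (1 - w * cnj w)"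
      by (rule dipole_radial[OF arc_dipole[of \<kappa> t, folded w_def]]) (simp add: b_def w_def base_arc_vel)
    also have "1 - w * cnj w = of_real (coN (std_arc M \<kappa> t))" by (simp add: coN_complex w_def)
    finally have "cmod (cnj w * b) = cmod (1 / 2 * w * of_real (coN (std_arc M \<kappa> t)))" by (rule arg_cong)
    then have "cmod w * cmod b = cmod w * (coN (std_arc M \<kappa> t) / 2)"
      using coN_arc_pos[of M \<kappa> t] by (simp add: norm_mult)
    \<comment> \<open>The radial identity carries a factor \<open>w\<close> and says nothing at the
      origin, where the speed is read off directly.\<close>
    moreover have "cmod b = coN (std_arc M \<kappa> t) / 2" if "w = 0"
      using that by (simp add: b_def base_arc_vel coN_base flip: w_def)
    ultimately have b: "cmod b = coN (std_arc M \<kappa> t) / 2" by auto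
    have e: "4 * (cmod b)\<^sup>2 / (coN (std_arc M \<kappa> t))\<^sup>2 = 1"
      unfolding b using coN_arc_pos[of M \<kappa> t] by (simp add: power_divide)
    show ?thesis
      unfolding eta_arc_vel e[unfolded b_def] using assms(1) by (simp add: power2_eq_square)
  qed
  from sasaki_length_constant_speed[OF assms(2) arc_deriv this] show ?thesis .
qed

lemma (in target) arc_ends_iff: "cmod (arc_base \<kappa> T) = R \<longleftrightarrow> (sn \<kappa> T)\<^sup>2 = (R / c)\<^sup>2"
proof -
  have "cmod (arc_base \<kappa> T) = R \<longleftrightarrow> (cmod (arc_base \<kappa> T))\<^sup>2 = R\<^sup>2"
    using R by (simp add: power2_eq_iff_nonneg)
  also have "\<dots> \<longleftrightarrow> (sn \<kappa> T)\<^sup>2 = R\<^sup>2 * (1 + (sn \<kappa> T)\<^sup>2)"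
    by (simp add: cmod_arc_base divide_eq_eq)
  also have "\<dots> \<longleftrightarrow> c\<^sup>2 * (sn \<kappa> T)\<^sup>2 = R\<^sup>2"
  proof -
    have "c\<^sup>2 = 1 - R\<^sup>2" using Rc by simp
    then show ?thesis by (simp only:) (auto simp: algebra_simps)
  qed
  also have "\<dots> \<longleftrightarrow> (sn \<kappa> T)\<^sup>2 = (R / c)\<^sup>2"
    using c by (simp add: power_divide eq_divide_eq mult.commute)
  finally show ?thesis .
qed

theorem theorem19p1:
  fixes M \<xi> R :: real
  assumes "M > 0" and "\<xi> > 0" and "0 < R" and "R < 1"
  shows "\<exists>T \<sigma>. admissible M R \<xi> T \<sigma> \<and> geodesic_multiplicity M T \<sigma> = 0 \<and>
           (\<forall>S \<tau>. admissible M R \<xi> S \<tau> \<longrightarrow>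
              sasaki_length M T \<sigma> \<le> sasaki_length M S \<tau> \<and>
              (sasaki_length M S \<tau> = sasaki_length M T \<sigma> \<longrightarrow> same_up_to_rescaling T \<sigma> S \<tau>))"
proof -
  define c where "c = sqrt (1 - R\<^sup>2)"
  have "0 < 1 - R\<^sup>2" using assms by (simp add: abs_square_less_1)
  then interpret target M R c
    using assms by unfold_locales (auto simp: c_def)
  from half_twist_surj[of "\<xi> / 2"] assms obtain X where
    X: "-1 < X" "X < 1 / c" "half_twist X = \<xi> / 2" by auto
  define \<kappa> T where "\<kappa> = curv X" and "T = 2 * half_len X"
  have kT: "0 < \<kappa>" "0 < T" using curv_pos half_len_pos X by (auto simp: \<kappa>_def T_def)
  note arc = arc_exists[OF X(1,2), folded \<kappa>_def T_def]
  have "admissible M R \<xi> T (std_arc M \<kappa>)"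
    unfolding admissible_def ends_on_circle_def invariant_twist_def
    using arc_standard_position[OF assms(1) kT(2)] arc(1) arc(3) X(3)
    by (simp add: arc_ends_iff) (simp add: half_twist_def half_area_def \<kappa>_def T_def algebra_simps)
  moreover have "geodesic_multiplicity M T (std_arc M \<kappa>) = 0"
  proof (rule arc_multiplicity_0[OF assms(1) kT arc(4)])
    show "0 \<le> turn \<kappa> T" "turn \<kappa> T < pi"
      using arc(3) cX[OF X(1,2)] arccos_lt_bounded[of "c * X"] by auto
  qed
  moreover have "sasaki_length M T (std_arc M \<kappa>) \<le> sasaki_length M S \<tau> \<and>
     (sasaki_length M S \<tau> = sasaki_length M T (std_arc M \<kappa>) \<longrightarrow> same_up_to_rescaling T (std_arc M \<kappa>) S \<tau>)"
    if adm: "admissible M R \<xi> S \<tau>" for S \<tau>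
  proof -
    from adm have sp: "standard_position M S \<tau>" and ends: "cmod (base (\<tau> S)) = R"
      and tw: "angle (\<tau> S) - angle (\<tau> 0) = \<xi>"
      by (auto simp: admissible_def ends_on_circle_def invariant_twist_def)
    obtain v k where
      v: "0 < v" "0 < S" and \<tau>: "\<And>t. t \<in> {0..S} \<Longrightarrow> \<tau> t = std_arc M k (v * t)"
      and len: "sasaki_length M S \<tau> = S * (v * sqrt (1 + M * k\<^sup>2))"
      by (rule standard_position_imp_arc[OF assms(1) sp]) (rule that)
    define L where "L = v * S"
    have L: "0 < L" using v by (simp add: L_def)
    have end_sn: "(sn k L)\<^sup>2 = (R / c)\<^sup>2"
      using ends \<tau>[of S] v by (simp add: L_def arc_ends_iff)
    have twist: "(M + 1) * k * L - 2 * turn k L = \<xi>"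
      using tw \<tau>[of S] \<tau>[of 0] v by (simp add: L_def)
    \<comment> \<open>A positive twist forces a clockwise arc.\<close>
    have k: "0 < k"
    proof -
      from turn_bounds[of L k] L obtain J where J: "turn k L = k * J" "0 \<le> J" "J \<le> L / 2" by auto
      have "\<xi> = k * ((M + 1) * L - 2 * J)" using twist J(1) by (simp add: algebra_simps)
      moreover have "0 < (M + 1) * L - 2 * J"
        using J(3) mult_pos_pos[OF assms(1) L] by (simp add: distrib_right)
      ultimately show ?thesis using assms(2) by (simp add: zero_less_mult_iff)
    qed
    have lenL: "sasaki_length M S \<tau> = L * sqrt (1 + M * k\<^sup>2)" by (simp add: len L_def)
    have lenT: "sasaki_length M T (std_arc M \<kappa>) = T * sqrt (1 + M * \<kappa>\<^sup>2)"
      by (rule sasaki_length_std_arc[OF assms(1) kT(2)])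
    show ?thesis
    proof (cases "1 < k \<and> pi \<le> rate k * L / 2")
      case True
      obtain u m where um: "0 < u" "u < pi" "1 \<le> (m::nat)"
        "L / 2 = R / c * ((u + m * pi) / sin u)" "curv (cos u) = k" "turn k L = arccos (c * cos u) + m * pi"
        by (rule arc_end_multiple[OF conjunct1[OF True] L end_sn conjunct2[OF True]])
      have "(M + 1) * (curv (cos u) * (L / 2)) - turn k L = half_twist X"
        using twist um(5) X(3) by (simp add: field_simps)
      from multiple_cover_longer[OF um(1,2,3,4,6) this X(1,2)]
      \<comment> \<open>The comparison was made for half lengths; here both sides are multiplied by
        4.\<close>
      have "(T * sqrt (1 + M * \<kappa>\<^sup>2))\<^sup>2 < (L * sqrt (1 + M * k\<^sup>2))\<^sup>2"
        using assms(1) unfolding um(5)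
        by (simp add: power_mult_distrib T_def \<kappa>_def power_divide add_nonneg_nonneg algebra_simps)
      then have "T * sqrt (1 + M * \<kappa>\<^sup>2) < L * sqrt (1 + M * k\<^sup>2)"
        by (rule power2_less_imp_less) (use L assms(1) in simp)
      then show ?thesis using lenL lenT by simp
    next
      case False
      have "rate k * L / 2 < pi" if "1 < k" using False that by simp
      then obtain Y where Y: "-1 < Y" "Y < 1 / c"
        "half_len Y = L / 2" "curv Y = k" "turn k L = arccos (c * Y)"
        by (rule arc_end_simple[OF k L end_sn])
      \<comment> \<open>Within multiplicity 0 the twist determines the arc, so the competitor is the
        candidate itself run at another speed.\<close>
      have "half_twist Y = \<xi> / 2"
        using twist Y by (simp add: half_twist_def half_area_def algebra_simps)
      moreover have "\<not> X < Y" "\<not> Y < X"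
        using half_twist_antimono[of X Y] half_twist_antimono[of Y X] X Y(1,2) calculation by linarith+
      ultimately have "Y = X" by simp
      then have eq: "k = \<kappa>" "L = T" using Y by (auto simp: \<kappa>_def T_def)
      have "same_up_to_rescaling T (std_arc M \<kappa>) S \<tau>"
        unfolding same_up_to_rescaling_def
      \<comment> \<open>Since \<open>L = v * S\<close> equals \<open>T\<close>, the factor
        \<open>S / T\<close> is \<open>1 / v\<close> and undoes the speed of
        \<open>\<tau>\<close>.\<close>
      proof (intro exI[of _ "S / T"] conjI ballI)
        fix t assume t: "t \<in> {0..T}"
        then have "S / T * t \<in> {0..S}" using kT v by (simp add: divide_le_eq mult_left_mono)
        moreover have "v * (S / T * t) = L / T * t" by (simp add: L_def)
        then have "v * (S / T * t) = t" using eq(2) kT(2) by simp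
        ultimately show "\<tau> (S / T * t) = std_arc M \<kappa> t" using \<tau>[of "S / T * t"] eq(1) by simp
      qed (use kT v in auto)
      then show ?thesis using lenL lenT eq by simp
    qed
  qed
  ultimately show ?thesis by blast
qed

end
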